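(* Let $G$ be a countable residually finite group and let $H_1\supseteq H_2\supseteq\cdots$ be a decreasing sequence of finite-index normal subgroups of $G$ with $\bigcap_nH_n=\{e\}$. Then for every integer $k>1$ and every real number $\kappa\in[0,1)$ there exists a Toeplitz element $x\in\{1,\dots,k\}^G$ with $$h_\Sigma(\overline{Gx},G)=\kappa\log k,$$ where $\Sigma=\{\sigma_n\colon G\to\mathrm{Sym}(G/H_n)\}_{n\in\mathbb N}$ is the sofic approximation defined by the natural action on cosets, $\sigma_n(g)(cH_n)=cg^{-1}H_n$.
   Context: $\mathbb N=\{1,2,\dots\}$; $e$ is the neutral element of $G$; $\mathrm{Sym}(V)$ is the group of bijections of a set $V$; $\overline{Gx}$ is the orbit closure of $x$. "Decreasing" for a sequence of subgroups means $H_{n+1}\subseteq H_n$ for all $n$ (not necessarily strictly). Sofic approximation: a sequence $\Sigma=\{\sigma_n\colon G\to\mathrm{Sym}(V_n)\}_{n\in\mathbb N}$ of maps, with $V_n$ finite sets, $\sigma_{n,s}:=\sigma_n(s)$, such that (S1) $|\{v\in V_n:\sigma_{n,st}(v)=\sigma_{n,s}\sigma_{n,t}(v)\}|/|V_n|\to1$ for all $s,t\in G$, and (S2) $|\{v\in V_n:\sigma_{n,s}(v)\ne\sigma_{n,t}(v)\}|/|V_n|\to1$ for all distinct $s,t\in G$. Sofic topological entropy: let $G$ act continuously on a compact metrizable space $X$, and let $d\le 1$ be a continuous pseudometric on $X$ that is dynamically generating (for distinct $x,y\in X$ there is $s\in G$ with $d(sx,sy)>0$). For maps $\varphi,\psi\colon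 V\to X$ from a finite set put $d_2(\varphi,\psi)=\big(\frac1{|V|}\sum_{v\in V}d(\varphi(v),\psi(v))^2\big)^{1/2}$ and $d_\infty(\varphi,\psi)=\max_{v\in V}d(\varphi(v),\psi(v))$. For finite $F\subset G$, $\delta>0$ and $\sigma\colon G\to\mathrm{Sym}(V)$, $\mathrm{Map}(d,F,\delta,\sigma)$ is the set of $\varphi\colon V\to X$ with $d_2(\varphi\sigma_s,s\varphi)\le\delta$ for all $s\in F$, where $(s\varphi)(v)=s(\varphi(v))$. $N_\epsilon(Y,\rho)$ is the maximal cardinality of a subset of $Y$ whose distinct points are at $\rho$-distance $>\epsilon$. Then $$h_\Sigma(X,G)=\sup_{\epsilon>0}\inf_{F\subset G\text{ finite}}\inf_{\delta>0}\limsup_{n\to\infty}\frac1{|V_n|}\log N_\epsilon(\mathrm{Map}(d,F,\delta,\sigma_n),d_\infty),$$ with $\log0=-\infty$; this value does not depend on the choice of $d$. Shift: $\{1,\dots,k\}^G$ has the product topology and the action $(gx)_h=x_{g^{-1}h}$. Toeplitz elements: for a subgroup $H$ of $G$ and $x\in\{1,\dots,k\}^G$, $\mathrm{Per}_H(x)=\{g\in G: x_{h^{-1}g}=x_g\text{ for all }h\in H\}$. $x$ is a Toeplitz element if there is a decreasing sequence $\{K_n\}$ of finite-index subgroups of $G$ such that $G=\bigcup_n\mathrm{Per}_{K_n}(x)$.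
   Formalization: "Countable group" is taken to mean countably infinite: for finite G the claim is false, since the entropy takes only finitely many values (for trivial G it is always 0). *)

theory Defs
  imports
    "HOL-Analysis.Analysis"
    "HOL-Algebra.Left_Coset"
    "HOL-Library.Extended_Nat"
begin

section \<open>Groups\<close>

definition finite_index_subgroup :: "('a, 'b) monoid_scheme \<Rightarrow> 'a set \<Rightarrow> bool" where
  "finite_index_subgroup G H \<longleftrightarrow> subgroup H G \<and> finite (lcosets\<^bsub>G\<^esub> H)"

definition residually_finite :: "('a, 'b) monoid_scheme \<Rightarrow> bool" where
  "residually_finite G \<longleftrightarrow>
     (\<forall>g\<in>carrier G. g \<noteq> \<one>\<^bsub>G\<^esub> \<longrightarrow> (\<exists>N. N \<lhd> G \<and> finite (lcosets\<^bsub>G\<^esub> N) \<and> g \<notin> N))"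

section \<open>Sofic approximations\<close>

text \<open>Only the values of \<open>\<sigma> n s\<close> on \<open>V n\<close> matter.\<close>

definition sofic_approximation ::
  "('a, 'b) monoid_scheme \<Rightarrow> (nat \<Rightarrow> 'v set) \<Rightarrow> (nat \<Rightarrow> 'a \<Rightarrow> 'v \<Rightarrow> 'v) \<Rightarrow> bool" where
  "sofic_approximation G V \<sigma> \<longleftrightarrow>
     (\<forall>n. finite (V n) \<and> V n \<noteq> {}) \<and>
     (\<forall>n. \<forall>s\<in>carrier G. bij_betw (\<sigma> n s) (V n) (V n)) \<and>
     (\<forall>s\<in>carrier G. \<forall>t\<in>carrier G.
        (\<lambda>n. real (card {v \<in> V n. \<sigma> n (s \<otimes>\<^bsub>G\<^esub> t) v = \<sigma> n s (\<sigma> n t v)}) / real (card (V n)))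
          \<longlonglongrightarrow> 1) \<and>
     (\<forall>s\<in>carrier G. \<forall>t\<in>carrier G. s \<noteq> t \<longrightarrow>
        (\<lambda>n. real (card {v \<in> V n. \<sigma> n s v \<noteq> \<sigma> n t v}) / real (card (V n))) \<longlonglongrightarrow> 1)"

text \<open>The action of \<open>g\<close> on cosets, \<open>c H \<mapsto> c g\<inverse> H\<close>, with the union running over all
  representatives \<open>c\<close>; for normal \<open>H\<close> they all give the same coset (\<open>coset_action_lcoset\<close>).\<close>

definition coset_action ::
  "('a, 'b) monoid_scheme \<Rightarrow> 'a set \<Rightarrow> 'a \<Rightarrow> 'a set \<Rightarrow> 'a set" where
  "coset_action G H g C = (\<Union>c\<in>C. (c \<otimes>\<^bsub>G\<^esub> inv\<^bsub>G\<^esub> g) <#\<^bsub>G\<^esub> H)"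

section \<open>Sofic topological entropy\<close>

definition dyn_gen_pseudometric ::
  "('a, 'b) monoid_scheme \<Rightarrow> 'x topology \<Rightarrow> ('a \<Rightarrow> 'x \<Rightarrow> 'x) \<Rightarrow> ('x \<Rightarrow> 'x \<Rightarrow> real) \<Rightarrow> bool" where
  "dyn_gen_pseudometric G X act d \<longleftrightarrow>
     (\<forall>x\<in>topspace X. d x x = 0) \<and>
     (\<forall>x\<in>topspace X. \<forall>y\<in>topspace X. 0 \<le> d x y \<and> d x y \<le> 1 \<and> d x y = d y x) \<and>
     (\<forall>x\<in>topspace X. \<forall>y\<in>topspace X. \<forall>z\<in>topspace X. d x z \<le> d x y + d y z) \<and>
     continuous_map (prod_topology X X) euclideanreal (\<lambda>(x, y). d x y) \<and>
     (\<forall>x\<in>topspace X. \<forall>y\<in>topspace X. x \<noteq> y \<longrightarrow>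
        (\<exists>s\<in>carrier G. d (act s x) (act s y) > 0))"

definition dist_2 :: "'v set \<Rightarrow> ('x \<Rightarrow> 'x \<Rightarrow> real) \<Rightarrow> ('v \<Rightarrow> 'x) \<Rightarrow> ('v \<Rightarrow> 'x) \<Rightarrow> real" where
  "dist_2 V d \<phi> \<psi> = sqrt ((\<Sum>v\<in>V. (d (\<phi> v) (\<psi> v))\<^sup>2) / real (card V))"

definition dist_inf :: "'v set \<Rightarrow> ('x \<Rightarrow> 'x \<Rightarrow> real) \<Rightarrow> ('v \<Rightarrow> 'x) \<Rightarrow> ('v \<Rightarrow> 'x) \<Rightarrow> real" where
  "dist_inf V d \<phi> \<psi> = Max ((\<lambda>v. d (\<phi> v) (\<psi> v)) ` V)"

definition Map_sofic ::
  "'x topology \<Rightarrow> ('a \<Rightarrow> 'x \<Rightarrow> 'x) \<Rightarrow> ('x \<Rightarrow> 'x \<Rightarrow> real) \<Rightarrow> 'a set \<Rightarrow> real \<Rightarrow> 'v set \<Rightarrow>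
     ('a \<Rightarrow> 'v \<Rightarrow> 'v) \<Rightarrow> ('v \<Rightarrow> 'x) set" where
  "Map_sofic X act d F \<delta> V \<sigma> =
     {\<phi> \<in> V \<rightarrow>\<^sub>E topspace X.
        \<forall>s\<in>F. dist_2 V d (\<lambda>v. \<phi> (\<sigma> s v)) (\<lambda>v. act s (\<phi> v)) \<le> \<delta>}"

definition sep_number :: "real \<Rightarrow> 'y set \<Rightarrow> ('y \<Rightarrow> 'y \<Rightarrow> real) \<Rightarrow> enat" where
  "sep_number \<epsilon> Y \<rho> =
     (SUP S \<in> {S. S \<subseteq> Y \<and> finite S \<and> (\<forall>x\<in>S. \<forall>y\<in>S. x \<noteq> y \<longrightarrow> \<rho> x y > \<epsilon>)}. enat (card S))"

definition log_enat :: "enat \<Rightarrow> ereal" where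
  "log_enat m = (case m of enat n \<Rightarrow> (if n = 0 then -\<infinity> else ereal (ln (real n))) | \<infinity> \<Rightarrow> \<infinity>)"

definition sofic_entropy_wrt ::
  "('a, 'b) monoid_scheme \<Rightarrow> (nat \<Rightarrow> 'v set) \<Rightarrow> (nat \<Rightarrow> 'a \<Rightarrow> 'v \<Rightarrow> 'v) \<Rightarrow> 'x topology \<Rightarrow>
     ('a \<Rightarrow> 'x \<Rightarrow> 'x) \<Rightarrow> ('x \<Rightarrow> 'x \<Rightarrow> real) \<Rightarrow> ereal" where
  "sofic_entropy_wrt G V \<sigma> X act d =
     (SUP \<epsilon>\<in>{0<..}. INF F\<in>{F. F \<subseteq> carrier G \<and> finite F}. INF \<delta>\<in>{0<..}.
        limsup (\<lambda>n. log_enat (sep_number \<epsilon> (Map_sofic X act d F \<delta> (V n) (\<sigma> n)) (dist_inf (V n) d))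
                      / ereal (real (card (V n)))))"

text \<open>The value does not depend on the dynamically generating pseudometric, which exists when
  \<open>X\<close> is metrizable (\<open>metrizable_imp_dyn_gen_pseudometric\<close>); hence the use of \<open>SOME\<close>.\<close>

definition sofic_entropy ::
  "('a, 'b) monoid_scheme \<Rightarrow> (nat \<Rightarrow> 'v set) \<Rightarrow> (nat \<Rightarrow> 'a \<Rightarrow> 'v \<Rightarrow> 'v) \<Rightarrow> 'x topology \<Rightarrow>
     ('a \<Rightarrow> 'x \<Rightarrow> 'x) \<Rightarrow> ereal" where
  "sofic_entropy G V \<sigma> X act =
     sofic_entropy_wrt G V \<sigma> X act (SOME d. dyn_gen_pseudometric G X act d)"

section \<open>Shifts and Toeplitz elements\<close>

definition full_shift :: "('a, 'b) monoid_scheme \<Rightarrow> nat \<Rightarrow> ('a \<Rightarrow> nat) topology" where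
  "full_shift G k = product_topology (\<lambda>_. discrete_topology {1..k}) (carrier G)"

definition shift :: "('a, 'b) monoid_scheme \<Rightarrow> 'a \<Rightarrow> ('a \<Rightarrow> nat) \<Rightarrow> 'a \<Rightarrow> nat" where
  "shift G g x = (\<lambda>h\<in>carrier G. x (inv\<^bsub>G\<^esub> g \<otimes>\<^bsub>G\<^esub> h))"

definition orbit_closure ::
  "('a, 'b) monoid_scheme \<Rightarrow> nat \<Rightarrow> ('a \<Rightarrow> nat) \<Rightarrow> ('a \<Rightarrow> nat) topology" where
  "orbit_closure G k x =
     subtopology (full_shift G k) (full_shift G k closure_of ((\<lambda>g. shift G g x) ` carrier G))"

definition Per :: "('a, 'b) monoid_scheme \<Rightarrow> 'a set \<Rightarrow> ('a \<Rightarrow> nat) \<Rightarrow> 'a set" where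
  "Per G H x = {g \<in> carrier G. \<forall>h\<in>H. x (inv\<^bsub>G\<^esub> h \<otimes>\<^bsub>G\<^esub> g) = x g}"

definition toeplitz :: "('a, 'b) monoid_scheme \<Rightarrow> nat \<Rightarrow> ('a \<Rightarrow> nat) \<Rightarrow> bool" where
  "toeplitz G k x \<longleftrightarrow>
     x \<in> topspace (full_shift G k) \<and>
     (\<exists>K :: nat \<Rightarrow> 'a set.
        (\<forall>n. finite_index_subgroup G (K n)) \<and> (\<forall>n. K (Suc n) \<subseteq> K n) \<and>
        carrier G = (\<Union>n. Per G (K n) x))"

section \<open>Well-definedness\<close>

lemma coset_action_lcoset:
  assumes "H \<lhd> G" "g \<in> carrier G" "c \<in> carrier G"
  shows "coset_action G H g (c <#\<^bsub>G\<^esub> H) = (c \<otimes>\<^bsub>G\<^esub> inv\<^bsub>G\<^esub> g) <#\<^bsub>G\<^esub> H"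
proof -
  interpret normal H G by fact
  have "(c \<otimes>\<^bsub>G\<^esub> h \<otimes>\<^bsub>G\<^esub> inv\<^bsub>G\<^esub> g) <#\<^bsub>G\<^esub> H = (c \<otimes>\<^bsub>G\<^esub> inv\<^bsub>G\<^esub> g) <#\<^bsub>G\<^esub> H" if h: "h \<in> H" for h
  proof -
    have hc: "h \<in> carrier G" using h by (rule mem_carrier)
    have "g \<otimes>\<^bsub>G\<^esub> h \<otimes>\<^bsub>G\<^esub> inv\<^bsub>G\<^esub> g \<in> H"
      using inv_op_closed2[OF assms(2) h] .
    moreover have "c \<otimes>\<^bsub>G\<^esub> h \<otimes>\<^bsub>G\<^esub> inv\<^bsub>G\<^esub> g
        = (c \<otimes>\<^bsub>G\<^esub> inv\<^bsub>G\<^esub> g) \<otimes>\<^bsub>G\<^esub> (g \<otimes>\<^bsub>G\<^esub> h \<otimes>\<^bsub>G\<^esub> inv\<^bsub>G\<^esub> g)"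
      using hc assms by (simp add: m_assoc flip: m_assoc[of "inv\<^bsub>G\<^esub> g" g])
    ultimately have "c \<otimes>\<^bsub>G\<^esub> h \<otimes>\<^bsub>G\<^esub> inv\<^bsub>G\<^esub> g \<in> (c \<otimes>\<^bsub>G\<^esub> inv\<^bsub>G\<^esub> g) <#\<^bsub>G\<^esub> H"
      by (auto simp: l_coset_def)
    then show ?thesis
      using l_repr_independence[OF _ _ is_subgroup] assms by (metis inv_closed m_closed)
  qed
  moreover have "c \<in> c <#\<^bsub>G\<^esub> H"
    using lcos_self[OF assms(3) is_subgroup] .
  ultimately show ?thesis
    unfolding coset_action_def by (auto simp: l_coset_def)
qed

lemma lcoset_eq_iff:
  assumes "H \<lhd> G" "a \<in> carrier G" "b \<in> carrier G"
  shows "a <#\<^bsub>G\<^esub> H = b <#\<^bsub>G\<^esub> H \<longleftrightarrow> inv\<^bsub>G\<^esub> a \<otimes>\<^bsub>G\<^esub> b \<in> H"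
proof -
  interpret normal H G by fact
  show ?thesis
  proof
    assume "a <#\<^bsub>G\<^esub> H = b <#\<^bsub>G\<^esub> H"
    then have "b \<in> a <#\<^bsub>G\<^esub> H" using lcos_self[OF assms(3) is_subgroup] by simp
    then obtain h where h: "h \<in> H" "b = a \<otimes>\<^bsub>G\<^esub> h" by (auto simp: l_coset_def)
    moreover have "h \<in> carrier G" using h by simp
    ultimately show "inv\<^bsub>G\<^esub> a \<otimes>\<^bsub>G\<^esub> b \<in> H"
      using assms by (simp flip: m_assoc)
  next
    assume "inv\<^bsub>G\<^esub> a \<otimes>\<^bsub>G\<^esub> b \<in> H"
    moreover have "b = a \<otimes>\<^bsub>G\<^esub> (inv\<^bsub>G\<^esub> a \<otimes>\<^bsub>G\<^esub> b)"
      using assms by (simp flip: m_assoc)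
    ultimately have "b \<in> a <#\<^bsub>G\<^esub> H" unfolding l_coset_def by blast
    then show "a <#\<^bsub>G\<^esub> H = b <#\<^bsub>G\<^esub> H"
      using l_repr_independence[OF _ assms(2) is_subgroup] by metis
  qed
qed

lemma sofic_approximation_cosets:
  fixes G (structure)
  assumes "group G"
    and normal: "\<And>n. H n \<lhd> G" and fin: "\<And>n. finite (lcosets H n)"
    and dec: "\<And>n. H (Suc n) \<subseteq> H n" and triv: "(\<Inter>n. H n) = {\<one>}"
  shows "sofic_approximation G (\<lambda>n. lcosets H n) (\<lambda>n. coset_action G (H n))"
proof -
  interpret group G by fact
  note act = coset_action_lcoset[OF normal]
  have ne: "lcosets H n \<noteq> {}" for n by (auto simp: LCOSETS_def)
  have card_pos: "card (lcosets H n) \<noteq> 0" for n using fin ne by simp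
  have mult: "coset_action G (H n) (s \<otimes> t) v = coset_action G (H n) s (coset_action G (H n) t v)"
    if "s \<in> carrier G" "t \<in> carrier G" "v \<in> lcosets H n" for n s t v
    using that by (auto simp: LCOSETS_def act inv_mult_group m_assoc)
  have closed: "coset_action G (H n) s v \<in> lcosets H n"
    if "s \<in> carrier G" "v \<in> lcosets H n" for n s v
    using that by (auto simp: LCOSETS_def act)
  have one: "coset_action G (H n) \<one> v = v" if "v \<in> lcosets H n" for n v
    using that by (auto simp: LCOSETS_def act)
  have bij: "bij_betw (coset_action G (H n) s) (lcosets H n) (lcosets H n)"
    if "s \<in> carrier G" for n s
    by (rule bij_betw_byWitness[where f' = "coset_action G (H n) (inv s)"])
      (use that closed in \<open>auto simp: one simp flip: mult\<close>)
  have free: "\<forall>\<^sub>F n in sequentially. \<forall>v\<in>lcosets H n. coset_action G (H n) s v \<noteq> coset_action G (H n) t v"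
    if st: "s \<in> carrier G" "t \<in> carrier G" "s \<noteq> t" for s t
  proof -
    have "s \<otimes> inv t \<noteq> \<one>" using st by (metis inv_equality inv_inv inv_closed)
    then obtain N where N: "s \<otimes> inv t \<notin> H N" using triv by blast
    have "coset_action G (H n) s v \<noteq> coset_action G (H n) t v"
      if n: "n \<ge> N" and v: "v \<in> lcosets H n" for n v
    proof
      assume eq: "coset_action G (H n) s v = coset_action G (H n) t v"
      obtain c where c: "c \<in> carrier G" "v = c <# H n" using v by (auto simp: LCOSETS_def)
      have "inv (c \<otimes> inv s) \<otimes> (c \<otimes> inv t) \<in> H n"
        using eq c st by (simp add: act lcoset_eq_iff[OF normal])
      moreover have "inv (c \<otimes> inv s) \<otimes> (c \<otimes> inv t) = s \<otimes> inv t"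
        using c st by (simp add: inv_mult_group m_assoc) (simp flip: m_assoc)
      ultimately have "s \<otimes> inv t \<in> H n" by simp
      then show False using N lift_Suc_antimono_le[of H, OF dec n] by blast
    qed
    then show ?thesis unfolding eventually_sequentially by blast
  qed
  have S1: "(\<lambda>n. real (card {v \<in> lcosets H n. coset_action G (H n) (s \<otimes> t) v =
      coset_action G (H n) s (coset_action G (H n) t v)}) / real (card (lcosets H n))) \<longlonglongrightarrow> 1"
    if "s \<in> carrier G" "t \<in> carrier G" for s t
  proof -
    have "{v \<in> lcosets H n. coset_action G (H n) (s \<otimes> t) v =
      coset_action G (H n) s (coset_action G (H n) t v)} = lcosets H n" for n
      using mult that by blast
    then show ?thesis by (simp only: divide_self_if of_nat_eq_0_iff card_pos if_False tendsto_const)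
  qed
  have S2: "(\<lambda>n. real (card {v \<in> lcosets H n. coset_action G (H n) s v \<noteq> coset_action G (H n) t v})
      / real (card (lcosets H n))) \<longlonglongrightarrow> 1"
    if st: "s \<in> carrier G" "t \<in> carrier G" "s \<noteq> t" for s t
  proof (rule tendsto_eventually)
    show "\<forall>\<^sub>F n in sequentially. real (card {v \<in> lcosets H n. coset_action G (H n) s v \<noteq>
       coset_action G (H n) t v}) / real (card (lcosets H n)) = 1"
      using free[OF st]
    proof eventually_elim
      case (elim n)
      then have "{v \<in> lcosets H n. coset_action G (H n) s v \<noteq> coset_action G (H n) t v} = lcosets H n"
        by blast
      then show ?case using card_pos by simp
    qed
  qed
  show ?thesis
    unfolding sofic_approximation_def using fin ne bij S1 S2 by auto
qed

lemma metrizable_imp_dyn_gen_pseudometric: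
  assumes "group G" "metrizable_space X" "\<And>x. x \<in> topspace X \<Longrightarrow> act \<one>\<^bsub>G\<^esub> x = x"
  shows "\<exists>d. dyn_gen_pseudometric G X act d"
proof -
  interpret G: group G by fact
  obtain M d where "Metric_space M d" and X: "X = Metric_space.mtopology M d"
    using assms(2) by (auto simp: metrizable_space_def)
  then interpret Metric_space M d by simp
  have top: "topspace X = M" by (simp add: X)
  let ?d = "\<lambda>x y. min 1 (d x y)"
  have "continuous_map (prod_topology X X) euclideanreal (\<lambda>p. d (fst p) (snd p))"
    using continuous_map_mdist[of "prod_topology X X" "metric (M, d)" fst snd]
    by (simp add: X mdist_metric continuous_map_fst continuous_map_snd)
  then have "continuous_map (prod_topology X X) euclideanreal (\<lambda>(x, y). ?d x y)"
    unfolding case_prod_beta by (intro continuous_map_real_min) auto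
  then have "dyn_gen_pseudometric G X act ?d"
    unfolding dyn_gen_pseudometric_def top
    using triangle commute assms(3)
    by (auto simp: top min_def intro!: bexI[of _ "\<one>\<^bsub>G\<^esub>"]) (smt (verit) nonneg triangle commute)+
  then show ?thesis by blast
qed

end

theory Submission
  imports Defs
begin

text \<open>
  Write \<open>V n\<close> for the set of cosets of \<open>H n\<close> and \<open>N n\<close> for its size. The element \<open>x\<close> is built by
  filling \<open>G\<close> step by step: at stage \<open>j\<close> its values are prescribed on a union \<open>A j\<close> of cosets of
  \<open>H (r j)\<close>, constantly on each of them, and the remaining cosets are the holes. The sets \<open>A j\<close>
  exhaust \<open>G\<close>, so \<open>x\<close> is Toeplitz, while the proportion of holes tends to \<open>\<kappa>\<close> from above;
  the entropy is the exponential growth rate of the number of ways to fill the holes.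

  Upper bound. A microstate \<open>\<phi>\<close> is essentially given by its letters \<open>\<phi> v \<one>\<close>, since at most points \<open>v\<close>
  the value \<open>\<phi> v\<close> at \<open>w\<close> is the letter at the translate of \<open>v\<close> by the inverse of \<open>w\<close>. For a
  fixed \<open>m = r j\<close> the set \<open>V n\<close> is tiled by copies of a transversal of \<open>H m\<close>. The pattern on a tile
  is one of \<open>x\<close>, hence is determined by the coset of \<open>H m\<close> where it sits in \<open>x\<close> and by the letters in
  the holes, so there are at most \<open>N m * k ^ h\<close> patterns if \<open>h\<close> is the number of holes
  (\<open>card_language\<close>). The logarithm of the number of microstates per point is thus about
  \<open>(ln (N m) + h * ln k) / N m\<close>, which tends to \<open>\<kappa> * ln k\<close> because \<open>N m\<close> tends to infinity; exceptional
  points cost arbitrarily little (\<open>sparse_labellings\<close>).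

  Lower bound. Any filling of the holes by letters gives a periodic configuration. Its
  translates form an exactly equivariant map on \<open>V n\<close>, but need not lie in the orbit closure.
  Therefore each stage also writes into \<open>x\<close>, for a finite window \<open>F j\<close>, every pattern that a
  filling of the holes of stage \<open>j\<close> can show in a translate of \<open>F j\<close> (\<open>realise_all_patterns\<close>). Only
  finitely many cells are used for this, which is a negligible proportion at a fine enough level.
  Replacing every translate of the periodic configuration by a point of the orbit that agrees with
  it on \<open>F j\<close> yields a microstate, and distinct fillings yield separated microstates
  (\<open>ex_many_microstates\<close>). Windows around single points are
  realised one at a time because \<open>G\<close> may lack Foelner sets along which to copy whole configurations.

  Both bounds are proved for an arbitrary dynamically generating pseudometric. It enters through
  two consequences of compactness: points that agree on a large finite window are close
  (\<open>agree_imp_close\<close>), and points with different letters at the neutral element are separated by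
  one of finitely many translations (\<open>origin_separation\<close>).
\<close>

section \<open>Towers of normal subgroups of finite index\<close>

locale coset_tower = group G for G (structure) +
  fixes H :: "nat \<Rightarrow> 'a set"
  assumes normal_H: "H n \<lhd> G"
    and finite_V: "finite (lcosets (H n))"
    and H_Suc: "H (Suc n) \<subseteq> H n"
    and Inter_H: "(\<Inter>n. H n) = {\<one>}"
    and infinite_G: "infinite (carrier G)"
begin

abbreviation V :: "nat \<Rightarrow> 'a set set" where
  "V n \<equiv> lcosets (H n)"

definition cls :: "nat \<Rightarrow> 'a \<Rightarrow> 'a set" where
  "cls n g = g <# H n"

definition rep :: "'a set \<Rightarrow> 'a" where
  "rep C = (SOME c. c \<in> C)"

text \<open>For a subset of the group, being a union of cosets of \<open>H n\<close>.\<close>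

definition saturated :: "nat \<Rightarrow> 'a set \<Rightarrow> bool" where
  "saturated n A \<longleftrightarrow> A \<subseteq> carrier G \<and> (\<forall>a\<in>A. cls n a \<subseteq> A)"

definition holes :: "nat \<Rightarrow> 'a set \<Rightarrow> 'a set set" where
  "holes n A = {C \<in> V n. C \<inter> A = {}}"

text \<open>The cosets of \<open>H n\<close> inside \<open>H m\<close>, that is, the points of \<open>V n\<close> at which the tiles given by a
  transversal of \<open>H m\<close> are centred.\<close>

definition subcosets :: "nat \<Rightarrow> nat \<Rightarrow> 'a set set" where
  "subcosets m n = cls n ` H m"

lemma subgroup_H: "subgroup (H n) G"
  using normal_H normal_imp_subgroup by blast

lemma H_carrier: "h \<in> H n \<Longrightarrow> h \<in> carrier G"
  by (rule subgroup.mem_carrier[OF subgroup_H])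

lemma H_antimono: "m \<le> n \<Longrightarrow> H n \<subseteq> H m"
  by (rule lift_Suc_antimono_le[of H, OF H_Suc])

lemma V_eq: "V n = cls n ` carrier G"
  by (auto simp: LCOSETS_def cls_def)

lemma cls_in_V: "g \<in> carrier G \<Longrightarrow> cls n g \<in> V n"
  by (auto simp: V_eq)

lemma V_nonempty: "V n \<noteq> {}"
  by (auto simp: V_eq)

lemma card_V_pos: "card (V n) > 0"
  using finite_V V_nonempty by (simp add: card_gt_0_iff)

lemma cls_eq_iff:
  "a \<in> carrier G \<Longrightarrow> b \<in> carrier G \<Longrightarrow> cls n a = cls n b \<longleftrightarrow> inv a \<otimes> b \<in> H n"
  unfolding cls_def by (rule lcoset_eq_iff[OF normal_H])

lemma mem_cls_iff:
  assumes "a \<in> carrier G"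
  shows "b \<in> cls n a \<longleftrightarrow> b \<in> carrier G \<and> cls n b = cls n a"
proof
  assume "b \<in> cls n a"
  then obtain h where h: "h \<in> H n" "b = a \<otimes> h" by (auto simp: cls_def l_coset_def)
  then have "inv a \<otimes> b = h" "b \<in> carrier G"
    using assms H_carrier by (auto simp flip: m_assoc)
  then show "b \<in> carrier G \<and> cls n b = cls n a" using assms h cls_eq_iff by metis
next
  assume "b \<in> carrier G \<and> cls n b = cls n a"
  then show "b \<in> cls n a" using lcos_self[OF _ subgroup_H, of b n] unfolding cls_def by auto
qed

lemma cls_mult:
  assumes "a \<in> carrier G" "a' \<in> carrier G" "b \<in> carrier G" "b' \<in> carrier G"
    and "cls n a = cls n a'" "cls n b = cls n b'"
  shows "cls n (a \<otimes> b) = cls n (a' \<otimes> b')"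
proof -
  interpret N: normal "H n" G by (rule normal_H)
  have 1: "inv a \<otimes> a' \<in> H n" "inv b \<otimes> b' \<in> H n" using assms cls_eq_iff by auto
  then have "inv b \<otimes> (inv a \<otimes> a') \<otimes> b \<in> H n" using assms N.inv_op_closed1 by blast
  then have "(inv b \<otimes> (inv a \<otimes> a') \<otimes> b) \<otimes> (inv b \<otimes> b') \<in> H n" using 1 by blast
  moreover have "(inv b \<otimes> (inv a \<otimes> a') \<otimes> b) \<otimes> (inv b \<otimes> b') = inv (a \<otimes> b) \<otimes> (a' \<otimes> b')"
  proof -
    have "b \<otimes> (inv b \<otimes> b') = b'" using assms by (simp flip: m_assoc)
    then show ?thesis using assms by (simp add: inv_mult_group m_assoc)
  qed
  ultimately show ?thesis using assms cls_eq_iff by simp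
qed

lemma cls_cancel_right:
  assumes "a \<in> carrier G" "a' \<in> carrier G" "b \<in> carrier G"
  shows "cls n (a \<otimes> b) = cls n (a' \<otimes> b) \<longleftrightarrow> cls n a = cls n a'"
proof
  assume "cls n (a \<otimes> b) = cls n (a' \<otimes> b)"
  then have "cls n ((a \<otimes> b) \<otimes> inv b) = cls n ((a' \<otimes> b) \<otimes> inv b)"
    by (rule cls_mult[rotated 4]) (use assms in auto)
  then show "cls n a = cls n a'" using assms by (simp add: m_assoc)
next
  assume "cls n a = cls n a'"
  then show "cls n (a \<otimes> b) = cls n (a' \<otimes> b)" by (rule cls_mult[rotated 4]) (use assms in auto)
qed

lemma cls_cancel_left:
  assumes "a \<in> carrier G" "b \<in> carrier G" "b' \<in> carrier G"
  shows "cls n (a \<otimes> b) = cls n (a \<otimes> b') \<longleftrightarrow> cls n b = cls n b'"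
proof
  assume "cls n (a \<otimes> b) = cls n (a \<otimes> b')"
  then have "cls n (inv a \<otimes> (a \<otimes> b)) = cls n (inv a \<otimes> (a \<otimes> b'))"
    by (rule cls_mult[rotated 5]) (use assms in auto)
  then show "cls n b = cls n b'" using assms by (simp flip: m_assoc)
next
  assume "cls n b = cls n b'"
  then show "cls n (a \<otimes> b) = cls n (a \<otimes> b')" by (rule cls_mult[rotated 5]) (use assms in auto)
qed

lemma cls_one_iff: "g \<in> carrier G \<Longrightarrow> cls n g = cls n \<one> \<longleftrightarrow> g \<in> H n"
  using cls_eq_iff[of "\<one>" g n] by auto

lemma cls_coarser:
  "m \<le> n \<Longrightarrow> a \<in> carrier G \<Longrightarrow> b \<in> carrier G \<Longrightarrow> cls n a = cls n b \<Longrightarrow> cls m a = cls m b"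
  using H_antimono[of m n] by (auto simp: cls_eq_iff)

lemma cls_H_mult:
  assumes "h \<in> H n" "g \<in> carrier G"
  shows "cls n (h \<otimes> g) = cls n g"
proof -
  have h: "h \<in> carrier G" "cls n h = cls n \<one>" using assms H_carrier cls_one_iff by auto
  show ?thesis using cls_mult[of h \<one> g g n] h assms by simp
qed

lemma coset_action_cls:
  "s \<in> carrier G \<Longrightarrow> c \<in> carrier G \<Longrightarrow> coset_action G (H n) s (cls n c) = cls n (c \<otimes> inv s)"
  unfolding cls_def by (rule coset_action_lcoset[OF normal_H])

lemma rep_in:
  assumes "C \<in> V n"
  shows "rep C \<in> C" "rep C \<in> carrier G" "cls n (rep C) = C"
proof -
  obtain g where g: "g \<in> carrier G" "C = cls n g" using assms V_eq by auto
  then have "g \<in> C" using mem_cls_iff by auto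
  then show "rep C \<in> C" unfolding rep_def by (rule someI)
  then show "rep C \<in> carrier G" "cls n (rep C) = C" using g mem_cls_iff by auto
qed

lemma coset_cases:
  assumes "C \<in> V n"
  obtains c where "c \<in> carrier G" "C = cls n c"
  using assms V_eq by auto

lemma saturatedD:
  assumes "saturated n A" "a \<in> carrier G" "b \<in> carrier G" "cls n a = cls n b"
  shows "a \<in> A \<longleftrightarrow> b \<in> A"
  using assms mem_cls_iff[of a b n] mem_cls_iff[of b a n] unfolding saturated_def by auto

lemma saturated_mono:
  assumes "saturated m A" "m \<le> n"
  shows "saturated n A"
  unfolding saturated_def
proof (intro conjI ballI subsetI)
  show A: "a \<in> carrier G" if "a \<in> A" for a using that assms unfolding saturated_def by auto
  fix a b assume a: "a \<in> A" and b: "b \<in> cls n a"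
  have b': "b \<in> carrier G" "cls n b = cls n a" using b A[OF a] mem_cls_iff by auto
  then have "cls m b = cls m a" using cls_coarser[OF assms(2)] A[OF a] by blast
  then show "b \<in> A" using saturatedD[OF assms(1) A[OF a] b'(1)] a by simp
qed

lemma cls_in_holes:
  assumes "saturated n A" "g \<in> carrier G"
  shows "cls n g \<in> holes n A \<longleftrightarrow> g \<notin> A"
proof -
  have "cls n g \<inter> A = {} \<longleftrightarrow> g \<notin> A"
    using saturatedD[OF assms(1,2)] mem_cls_iff[OF assms(2)] assms(2) by fastforce
  then show ?thesis unfolding holes_def using assms cls_in_V by blast
qed

lemma finite_holes: "finite (holes n A)"
  unfolding holes_def using finite_V by simp

lemma holes_empty: "holes n {} = V n"
  unfolding holes_def by auto

lemma saturated_empty: "saturated n {}"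
  unfolding saturated_def by auto

text \<open>Each coset of \<open>H m\<close> splits into translates of the cosets of \<open>H n\<close> inside \<open>H m\<close>. Hence the
  proportion of holes does not change when the same set is viewed at a finer level.\<close>

lemma card_holes_refine:
  assumes mn: "m \<le> n" and A: "saturated m A"
  shows "card (holes n A) = card (holes m A) * card (subcosets m n)"
proof -
  let ?f = "\<lambda>(D, E). cls n (rep E \<otimes> rep D)"
  have An: "saturated n A" using saturated_mono[OF A mn] .
  have E: "rep E \<in> carrier G" "cls n (rep E) = E" "cls m (rep E) = cls m \<one>"
    if E0: "E \<in> subcosets m n" for E
  proof -
    obtain e where e: "e \<in> H m" "E = cls n e" using E0 unfolding subcosets_def by auto
    have E: "E \<in> V n" using e H_carrier cls_in_V by auto
    then show *: "rep E \<in> carrier G" "cls n (rep E) = E" using rep_in by auto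
    then have "cls m (rep E) = cls m e" using e cls_coarser[OF mn *(1), of e] H_carrier[of e m] by simp
    then show "cls m (rep E) = cls m \<one>" using e cls_one_iff[of e m] H_carrier[of e m] by simp
  qed
  have D: "rep D \<in> carrier G" "cls m (rep D) = D" "rep D \<notin> A" if "D \<in> holes m A" for D
    using that rep_in[of D m] unfolding holes_def by auto
  have m: "cls m (rep E \<otimes> rep D) = D" if "D \<in> holes m A" "E \<in> subcosets m n" for D E
    using cls_mult[of "rep E" \<one> "rep D" "rep D" m] D[OF that(1)] E[OF that(2)] by simp
  have "bij_betw ?f (holes m A \<times> subcosets m n) (holes n A)"
  proof (rule bij_betwI')
    fix p p' assume p: "p \<in> holes m A \<times> subcosets m n" and p': "p' \<in> holes m A \<times> subcosets m n"
    obtain D0 E0 D' E' where [simp]: "p = (D0, E0)" "p' = (D', E')" by fastforce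
    have DE: "D0 \<in> holes m A" "E0 \<in> subcosets m n" "D' \<in> holes m A" "E' \<in> subcosets m n"
      using p p' by auto
    have "D0 = D' \<and> E0 = E'" if eq: "cls n (rep E0 \<otimes> rep D0) = cls n (rep E' \<otimes> rep D')"
    proof -
      have "cls m (rep E0 \<otimes> rep D0) = cls m (rep E' \<otimes> rep D')"
        by (rule cls_coarser[OF mn _ _ eq]) (use D E DE in auto)
      then have [simp]: "D' = D0" using m DE by auto
      have "cls n (rep E0) = cls n (rep E')"
        using eq cls_cancel_right D E DE by simp
      then show ?thesis using E DE by auto
    qed
    then show "(?f p = ?f p') = (p = p')" by auto
  next
    fix p assume "p \<in> holes m A \<times> subcosets m n"
    then obtain D0 E0 where [simp]: "p = (D0, E0)" and DE: "D0 \<in> holes m A" "E0 \<in> subcosets m n"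
      by auto
    have "rep E0 \<otimes> rep D0 \<notin> A"
      using saturatedD[OF A, of "rep E0 \<otimes> rep D0" "rep D0"] m D E DE by simp
    then show "?f p \<in> holes n A" using cls_in_holes[OF An] D E DE by simp
  next
    fix C assume "C \<in> holes n A"
    then have C: "C \<in> V n" "C \<inter> A = {}" unfolding holes_def by auto
    let ?c = "rep C"
    let ?D = "cls m ?c"
    have c: "?c \<in> carrier G" "cls n ?c = C" "?c \<notin> A" using rep_in[OF C(1)] C(2) by auto
    have Dh: "?D \<in> holes m A" using cls_in_holes[OF A] c by simp
    let ?e = "?c \<otimes> inv (rep ?D)"
    have e: "?e \<in> carrier G" using c D[OF Dh] by auto
    have "cls m ?e = cls m (rep ?D \<otimes> inv (rep ?D))"
      by (subst cls_cancel_right) (use c D[OF Dh] in simp_all)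
    then have "?e \<in> H m" using D[OF Dh] cls_one_iff e by simp
    then have Eh: "cls n ?e \<in> subcosets m n" unfolding subcosets_def by auto
    have "cls n (rep (cls n ?e) \<otimes> rep ?D) = cls n (?e \<otimes> rep ?D)"
      using cls_cancel_right E[OF Eh] D[OF Dh] e by simp
    also have "?e \<otimes> rep ?D = ?c" using c D[OF Dh] by (simp add: m_assoc)
    finally have "?f (?D, cls n ?e) = C" using c by simp
    then show "\<exists>p\<in>holes m A \<times> subcosets m n. C = ?f p" using Dh Eh by blast
  qed
  then have "card (holes m A \<times> subcosets m n) = card (holes n A)" by (rule bij_betw_same_card)
  then show ?thesis by (simp add: card_cartesian_product)
qed

lemma card_V_refine: "m \<le> n \<Longrightarrow> card (V n) = card (V m) * card (subcosets m n)"
  using card_holes_refine[of m n "{}"] saturated_empty holes_empty by simp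

text \<open>Since the \<open>H n\<close> decrease to the trivial group, finitely many elements end up in distinct cosets.\<close>

lemma finite_injective_level:
  assumes "finite S" "S \<subseteq> carrier G"
  shows "\<exists>n0. \<forall>n\<ge>n0. inj_on (cls n) S"
proof -
  have "\<exists>n0. \<forall>s\<in>S. \<forall>t\<in>S. s \<noteq> t \<longrightarrow> inv s \<otimes> t \<notin> H n0"
  proof -
    have *: "\<exists>n. inv s \<otimes> t \<notin> H n" if "s \<in> S" "t \<in> S" "s \<noteq> t" for s t
    proof -
      have "inv s \<otimes> t \<noteq> \<one>" using that assms by (metis inv_equality inv_inv inv_closed subsetD)
      then show ?thesis using Inter_H by blast
    qed
    define f where "f = (\<lambda>(s, t). SOME n. inv s \<otimes> t \<notin> H n)"
    define n0 where "n0 = Max (f ` (S \<times> S) \<union> {0})"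
    have "inv s \<otimes> t \<notin> H n0" if "s \<in> S" "t \<in> S" "s \<noteq> t" for s t
    proof -
      have "inv s \<otimes> t \<notin> H (f (s, t))" unfolding f_def using someI_ex[OF *[OF that]] by simp
      moreover have "f (s, t) \<le> n0" unfolding n0_def using assms that by (intro Max_ge) auto
      ultimately show ?thesis using H_antimono by blast
    qed
    then show ?thesis by blast
  qed
  then obtain n0 where n0: "\<forall>s\<in>S. \<forall>t\<in>S. s \<noteq> t \<longrightarrow> inv s \<otimes> t \<notin> H n0" by blast
  have "inj_on (cls n) S" if "n \<ge> n0" for n
  proof (rule inj_onI)
    fix s t assume st: "s \<in> S" "t \<in> S" "cls n s = cls n t"
    then have "inv s \<otimes> t \<in> H n" using assms by (auto simp: cls_eq_iff subset_iff)
    then show "s = t" using st n0 H_antimono[OF that] by blast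
  qed
  then show ?thesis by blast
qed

lemma card_V_unbounded: "\<exists>n0. \<forall>n\<ge>n0. K \<le> card (V n)"
proof -
  obtain S where S: "finite S" "card S = K" "S \<subseteq> carrier G"
    using infinite_arbitrarily_large[OF infinite_G] by blast
  obtain n0 where n0: "\<forall>n\<ge>n0. inj_on (cls n) S" using finite_injective_level S by blast
  have "K \<le> card (V n)" if "n \<ge> n0" for n
    using card_inj_on_le[of "cls n" S "V n"] n0 that S finite_V V_eq by auto
  then show ?thesis by blast
qed

lemma infinite_H: "infinite (H n)"
proof
  assume fin: "finite (H n)"
  have "finite C" if "C \<in> V n" for C
    using that fin by (auto simp: V_eq cls_def l_coset_def)
  then have "finite (\<Union>(V n))" using finite_V by blast
  then show False using lcosets_part_G[OF subgroup_H] infinite_G by simp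
qed

section \<open>Constructing the Toeplitz element\<close>

definition coset_constant :: "nat \<Rightarrow> 'a set \<Rightarrow> ('a \<Rightarrow> 'c) \<Rightarrow> bool" where
  "coset_constant n A y \<longleftrightarrow> (\<forall>a\<in>A. \<forall>b\<in>cls n a. y b = y a)"

lemma coset_constantD:
  assumes "coset_constant n A y" "a \<in> A" "a \<in> carrier G" "b \<in> carrier G" "cls n a = cls n b"
  shows "y a = y b"
  using assms mem_cls_iff[of a b n] unfolding coset_constant_def by auto

text \<open>Finitely many prescribed patterns, each compatible with the values already fixed on \<open>A\<close>, are
  written into one configuration one after the other: the infinite group \<open>H n\<close> contains an element
  \<open>h\<close> that moves the next window off all cells used so far. As \<open>H n\<close> is normal, moving by \<open>h\<close>
  changes neither membership in \<open>A\<close> nor the values there, so compatibility is preserved.\<close>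

lemma realise_patterns:
  assumes F: "finite F" "F \<subseteq> carrier G" and S0: "finite S0" "S0 \<subseteq> carrier G"
    and A: "saturated n A" and y: "coset_constant n A y" "y \<in> carrier G \<rightarrow> K"
    and "finite Ts"
    and "\<forall>(c, \<pi>)\<in>Ts. c \<in> carrier G \<and> (\<forall>f\<in>F. \<pi> f \<in> K \<and> (c \<otimes> f \<in> A \<longrightarrow> \<pi> f = y (c \<otimes> f)))"
  shows "\<exists>S q. finite S \<and> S0 \<subseteq> S \<and> S \<subseteq> carrier G \<and> q \<in> carrier G \<rightarrow> K \<and> (\<forall>u\<in>A. q u = y u) \<and>
    (\<forall>(c, \<pi>)\<in>Ts. \<exists>h\<in>H n. \<forall>f\<in>F. h \<otimes> (c \<otimes> f) \<in> S \<and> q (h \<otimes> (c \<otimes> f)) = \<pi> f)"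
  using assms(8,9)
proof (induction Ts rule: finite_induct)
  case empty
  show ?case using S0 y by (intro exI[of _ S0] exI[of _ y]) auto
next
  case (insert T Ts)
  obtain c \<pi> where T: "T = (c, \<pi>)" by fastforce
  have c: "c \<in> carrier G" "\<And>f. f \<in> F \<Longrightarrow> \<pi> f \<in> K"
    "\<And>f. f \<in> F \<Longrightarrow> c \<otimes> f \<in> A \<Longrightarrow> \<pi> f = y (c \<otimes> f)"
    using insert.prems T by auto
  obtain S q where S: "finite S" "S0 \<subseteq> S" "S \<subseteq> carrier G" and q: "q \<in> carrier G \<rightarrow> K" "\<forall>u\<in>A. q u = y u"
    and Sq: "\<forall>(c, \<pi>)\<in>Ts. \<exists>h\<in>H n. \<forall>f\<in>F. h \<otimes> (c \<otimes> f) \<in> S \<and> q (h \<otimes> (c \<otimes> f)) = \<pi> f"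
    using insert.IH insert.prems by auto
  let ?bad = "(\<lambda>(s, f). s \<otimes> inv (c \<otimes> f)) ` (S \<times> F)"
  have "finite ?bad" using S F by auto
  then obtain h where h: "h \<in> H n" "h \<notin> ?bad"
    using infinite_H[of n] by (meson finite_subset subsetI)
  have hG: "h \<in> carrier G" using h H_carrier by auto
  have FG: "f \<in> carrier G" if "f \<in> F" for f using that F by auto
  have fresh: "h \<otimes> (c \<otimes> f) \<notin> S" if f: "f \<in> F" for f
  proof
    assume "h \<otimes> (c \<otimes> f) \<in> S"
    moreover have "h = (h \<otimes> (c \<otimes> f)) \<otimes> inv (c \<otimes> f)"
      using hG c(1) FG[OF f] by (simp add: m_assoc)
    ultimately have "h \<in> ?bad" using f by force
    then show False using h by simp
  qed
  define S' where "S' = S \<union> (\<lambda>f. h \<otimes> (c \<otimes> f)) ` F"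
  define q' where "q' = (\<lambda>u. if u \<in> (\<lambda>f. h \<otimes> (c \<otimes> f)) ` F then \<pi> (inv (h \<otimes> c) \<otimes> u) else q u)"
  have retract: "inv (h \<otimes> c) \<otimes> (h \<otimes> (c \<otimes> f)) = f" if "f \<in> F" for f
  proof -
    have "inv x \<otimes> (x \<otimes> f) = f" if "x \<in> carrier G" for x
      using that FG[OF \<open>f \<in> F\<close>] by (simp flip: m_assoc)
    from this[of "h \<otimes> c"] show ?thesis using hG c(1) FG[OF that] by (simp add: m_assoc)
  qed
  have q'1: "q' (h \<otimes> (c \<otimes> f)) = \<pi> f" if "f \<in> F" for f
    using that retract unfolding q'_def by auto
  have q'2: "q' u = q u" if "u \<in> S" for u
    using that fresh unfolding q'_def by auto
  have "q' u \<in> K" if "u \<in> carrier G" for u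
    using that q c(2) retract unfolding q'_def by auto
  moreover have "q' u = y u" if u: "u \<in> A" for u
  proof (cases "u \<in> (\<lambda>f. h \<otimes> (c \<otimes> f)) ` F")
    case True
    then obtain f where f: "f \<in> F" "u = h \<otimes> (c \<otimes> f)" by auto
    have cl: "cls n u = cls n (c \<otimes> f)" using f cls_H_mult[OF h(1)] c(1) FG by simp
    have "c \<otimes> f \<in> A" using saturatedD[OF A _ _ cl] u f hG c(1) FG by simp
    then have "\<pi> f = y (c \<otimes> f)" using c f by simp
    also have "\<dots> = y u" using coset_constantD[OF y(1) \<open>c \<otimes> f \<in> A\<close> _ _ cl[symmetric]] f hG c(1) FG
      by simp
    finally show ?thesis using q'1 f by simp
  next
    case False
    then show ?thesis using q u unfolding q'_def by simp
  qed
  moreover have "\<exists>h\<in>H n. \<forall>f\<in>F. h \<otimes> (c \<otimes> f) \<in> S' \<and> q' (h \<otimes> (c \<otimes> f)) = \<pi> f"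
    if "(c, \<pi>) \<in> insert T Ts" for c \<pi>
  proof (cases "(c, \<pi>) = T")
    case True
    then show ?thesis using h q'1 T unfolding S'_def by auto
  next
    case False
    then have "(c, \<pi>) \<in> Ts" using that by simp
    then obtain h' where "h' \<in> H n" "\<forall>f\<in>F. h' \<otimes> (c \<otimes> f) \<in> S \<and> q (h' \<otimes> (c \<otimes> f)) = \<pi> f"
      using Sq by blast
    then show ?thesis using q'2 unfolding S'_def by auto
  qed
  moreover have "finite S'" "S0 \<subseteq> S'" "S' \<subseteq> carrier G"
    using S F hG c(1) FG unfolding S'_def by auto
  ultimately show ?case by (intro exI[of _ S'] exI[of _ q']) auto
qed

text \<open>Up to translation by \<open>H n\<close> there are finitely many windows \<open>c F\<close>, and each carries finitely many
  patterns, so the previous lemma covers all of them at once.\<close>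

lemma realise_all_patterns:
  assumes F: "finite F" "F \<subseteq> carrier G" and K: "finite K"
    and A: "saturated n A" and y: "coset_constant n A y" "y \<in> carrier G \<rightarrow> K"
  shows "\<exists>S q. finite S \<and> F \<subseteq> S \<and> S \<subseteq> carrier G \<and> q \<in> carrier G \<rightarrow> K \<and> (\<forall>u\<in>A. q u = y u) \<and>
    (\<forall>c\<in>carrier G. \<forall>p\<in>carrier G \<rightarrow> K. (\<forall>u\<in>A. p u = y u) \<longrightarrow>
       (\<exists>g\<in>carrier G. \<forall>f\<in>F. g \<otimes> f \<in> S \<and> q (g \<otimes> f) = p (c \<otimes> f)))"
proof -
  define Ts where "Ts = {(c, \<pi>). c \<in> rep ` V n \<and> \<pi> \<in> F \<rightarrow>\<^sub>E K \<and> (\<forall>f\<in>F. c \<otimes> f \<in> A \<longrightarrow> \<pi> f = y (c \<otimes> f))}"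
  have finT: "finite Ts"
    by (rule finite_subset[of _ "rep ` V n \<times> (F \<rightarrow>\<^sub>E K)"])
      (use finite_V[of n] F K in \<open>auto simp: Ts_def intro!: finite_PiE finite_cartesian_product\<close>)
  have okT: "\<forall>(c, \<pi>)\<in>Ts. c \<in> carrier G \<and> (\<forall>f\<in>F. \<pi> f \<in> K \<and> (c \<otimes> f \<in> A \<longrightarrow> \<pi> f = y (c \<otimes> f)))"
    using rep_in by (auto simp: Ts_def)
  obtain S q where S: "finite S" "F \<subseteq> S" "S \<subseteq> carrier G" and q: "q \<in> carrier G \<rightarrow> K" "\<forall>u\<in>A. q u = y u"
    and Sq: "\<forall>(c, \<pi>)\<in>Ts. \<exists>h\<in>H n. \<forall>f\<in>F. h \<otimes> (c \<otimes> f) \<in> S \<and> q (h \<otimes> (c \<otimes> f)) = \<pi> f"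
    using realise_patterns[OF F F A y finT okT] by (elim exE conjE) (rule that)
  have "\<exists>g\<in>carrier G. \<forall>f\<in>F. g \<otimes> f \<in> S \<and> q (g \<otimes> f) = p (c \<otimes> f)"
    if c: "c \<in> carrier G" and p: "p \<in> carrier G \<rightarrow> K" "\<forall>u\<in>A. p u = y u" for c p
  proof -
    let ?c = "rep (cls n c)"
    have c0: "?c \<in> carrier G" "cls n ?c = cls n c" "?c \<in> rep ` V n"
      using rep_in[OF cls_in_V[OF c, of n]] cls_in_V[OF c, of n] by auto
    have FG: "f \<in> carrier G" if "f \<in> F" for f using that F by auto
    have cf: "cls n (?c \<otimes> f) = cls n (c \<otimes> f)" if "f \<in> F" for f
      using cls_cancel_right c c0 FG[OF that] by blast
    define \<pi> where "\<pi> = (\<lambda>f\<in>F. p (c \<otimes> f))"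
    have "\<pi> f = y (?c \<otimes> f)" if f: "f \<in> F" "?c \<otimes> f \<in> A" for f
    proof -
      have "c \<otimes> f \<in> A" using saturatedD[OF A _ _ cf] f c c0 FG by simp
      then have "\<pi> f = y (c \<otimes> f)" unfolding \<pi>_def using p f by simp
      then show ?thesis using coset_constantD[OF y(1) f(2) _ _ cf] f c c0 FG by simp
    qed
    then have "(?c, \<pi>) \<in> Ts" using c0 p c FG unfolding Ts_def \<pi>_def by auto
    then obtain h where h: "h \<in> H n" "\<forall>f\<in>F. h \<otimes> (?c \<otimes> f) \<in> S \<and> q (h \<otimes> (?c \<otimes> f)) = \<pi> f"
      using Sq by blast
    have "h \<in> carrier G" using h H_carrier by auto
    then have "h \<otimes> ?c \<in> carrier G" "\<And>f. f \<in> F \<Longrightarrow> (h \<otimes> ?c) \<otimes> f = h \<otimes> (?c \<otimes> f)"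
      using c0 FG by (auto simp: m_assoc)
    then show ?thesis using h unfolding \<pi>_def by (intro bexI[of _ "h \<otimes> ?c"]) auto
  qed
  then show ?thesis using S q by (intro exI[of _ S] exI[of _ q]) auto
qed

text \<open>The number of holes exceeds \<open>\<kappa> * card (V m)\<close> by an amount proportional to \<open>card (V m)\<close>, hence
  eventually by more than any constant.\<close>

lemma exists_level_with_room:
  fixes \<kappa> L :: real
  assumes A: "saturated n A" and gap: "\<kappa> * card (V n) < card (holes n A)"
  shows "\<exists>m0. \<forall>m\<ge>m0. n \<le> m \<longrightarrow> \<kappa> * card (V m) + L \<le> card (holes m A)"
proof -
  define \<gamma> where "\<gamma> = card (holes n A) / card (V n) - \<kappa>"
  have \<gamma>: "\<gamma> > 0" using gap card_V_pos[of n] by (simp add: \<gamma>_def field_simps)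
  obtain m0 where m0: "\<forall>m\<ge>m0. nat \<lceil>L / \<gamma>\<rceil> \<le> card (V m)" using card_V_unbounded by blast
  have "\<kappa> * card (V m) + L \<le> card (holes m A)" if m: "m \<ge> m0" "n \<le> m" for m
  proof -
    have "card (holes m A) * card (V n) = card (holes n A) * card (V m)"
      using card_holes_refine[OF m(2) A] card_V_refine[OF m(2)] by simp
    then have "real (card (holes m A)) * card (V n) = card (holes n A) * real (card (V m))"
      by (metis of_nat_mult)
    then have eq: "real (card (holes m A)) = (\<gamma> + \<kappa>) * card (V m)"
      using card_V_pos[of n] by (simp add: \<gamma>_def field_simps)
    have "nat \<lceil>L / \<gamma>\<rceil> \<le> card (V m)" using m0 m by blast
    then have "L / \<gamma> \<le> card (V m)" by linarith
    then have "L \<le> \<gamma> * card (V m)" using \<gamma> by (simp add: field_simps)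
    then show ?thesis using eq by (simp add: algebra_simps)
  qed
  then show ?thesis by blast
qed

text \<open>One stage of the construction. The finite set \<open>S\<close> carrying the required patterns is spread over
  its cosets at a level \<open>n'\<close> where it meets each coset at most once, and then further cosets are
  filled with an arbitrary letter until exactly \<open>\<lfloor>\<kappa> * card (V n')\<rfloor> + 1\<close> holes are left: this is
  the least number of holes above \<open>\<kappa> * card (V n')\<close>.\<close>

lemma filling_step:
  fixes \<kappa> :: real
  assumes F: "finite F" "F \<subseteq> carrier G" and K: "finite K" "K \<noteq> {}" and \<kappa>: "0 \<le> \<kappa>"
    and A: "saturated n A" and y: "coset_constant n A y" "y \<in> carrier G \<rightarrow> K"
    and gap: "\<kappa> * card (V n) < card (holes n A)"
  shows "\<exists>n' A' y'. n < n' \<and> saturated n' A' \<and> coset_constant n' A' y' \<and> y' \<in> carrier G \<rightarrow> K \<and>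
     \<kappa> * card (V n') < card (holes n' A') \<and> card (holes n' A') \<le> \<kappa> * card (V n') + 1 \<and>
     A \<subseteq> A' \<and> F \<subseteq> A' \<and> (\<forall>u\<in>A. y' u = y u) \<and>
     (\<forall>c\<in>carrier G. \<forall>p\<in>carrier G \<rightarrow> K. (\<forall>u\<in>A. p u = y u) \<longrightarrow>
       (\<exists>g\<in>carrier G. \<forall>f\<in>F. g \<otimes> f \<in> A' \<and> y' (g \<otimes> f) = p (c \<otimes> f)))"
proof -
  obtain S q where S: "finite S" "F \<subseteq> S" "S \<subseteq> carrier G" and q: "q \<in> carrier G \<rightarrow> K" "\<forall>u\<in>A. q u = y u"
    and Sq: "\<forall>c\<in>carrier G. \<forall>p\<in>carrier G \<rightarrow> K. (\<forall>u\<in>A. p u = y u) \<longrightarrow>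
       (\<exists>g\<in>carrier G. \<forall>f\<in>F. g \<otimes> f \<in> S \<and> q (g \<otimes> f) = p (c \<otimes> f))"
    using realise_all_patterns[OF F K(1) A y] by (elim exE conjE) (rule that)
  (* room for the cosets that S occupies, plus one for rounding up the number of holes *)
  obtain m0 where m0: "\<forall>m\<ge>m0. n \<le> m \<longrightarrow> \<kappa> * card (V m) + real (card S + 1) \<le> card (holes m A)"
    using exists_level_with_room[OF A gap] by blast
  obtain m1 where m1: "\<forall>m\<ge>m1. inj_on (cls m) S" using finite_injective_level S by blast
  define n' where "n' = max (Suc n) (max m0 m1)"
  have n': "n < n'" "n' \<ge> m0" "n' \<ge> m1" unfolding n'_def by auto
  have A': "saturated n' A" using saturated_mono[OF A] n' by simp
  have room: "\<kappa> * card (V n') + real (card S + 1) \<le> card (holes n' A)" using m0 n' by simp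
  have inj: "inj_on (cls n') S" using m1 n' by blast
  define Z where "Z = holes n' A - cls n' ` S"
  have "card (holes n' A) \<le> card Z + card S"
  proof -
    have "card (holes n' A) \<le> card (Z \<union> cls n' ` S)"
      unfolding Z_def by (intro card_mono) (use S finite_holes in auto)
    also have "\<dots> \<le> card Z + card (cls n' ` S)" by (rule card_Un_le)
    also have "\<dots> \<le> card Z + card S" using card_image_le[OF S(1)] by simp
    finally show ?thesis .
  qed
  then have Zbig: "\<kappa> * card (V n') + 1 \<le> card Z" using room by linarith
  define h where "h = nat \<lfloor>\<kappa> * card (V n')\<rfloor> + 1"
  have h: "\<kappa> * card (V n') < h" "h \<le> \<kappa> * card (V n') + 1"
    unfolding h_def using \<kappa> by (simp_all add: floor_less_iff) linarith+
  have "h \<le> card Z" using h Zbig by linarith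
  then obtain Z0 where Z0: "Z0 \<subseteq> Z" "card Z0 = h" "finite Z0"
    using obtain_subset_with_card_n by blast
  have Z0V: "Z0 \<subseteq> V n'" using Z0 unfolding Z_def holes_def by auto
  define A1 where "A1 = {g \<in> carrier G. cls n' g \<notin> Z0}"
  obtain a0 where a0: "a0 \<in> K" using K by blast
  define y1 where "y1 = (\<lambda>u. if u \<in> A then y u
      else if cls n' u \<in> cls n' ` S then q (the_inv_into S (cls n') (cls n' u)) else a0)"
  have AG: "A \<subseteq> carrier G" using A unfolding saturated_def by blast
  have satA1: "saturated n' A1"
    unfolding saturated_def A1_def using mem_cls_iff by auto
  have holes1: "holes n' A1 = Z0"
  proof -
    have "cls n' g \<in> holes n' A1 \<longleftrightarrow> cls n' g \<in> Z0" if "g \<in> carrier G" for g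
      using cls_in_holes[OF satA1 that] that unfolding A1_def by auto
    moreover have "holes n' A1 \<subseteq> V n'" unfolding holes_def by auto
    ultimately show ?thesis using Z0V unfolding V_eq by blast
  qed
  have AA1: "A \<subseteq> A1"
    using Z0 AG cls_in_holes[OF A'] unfolding A1_def Z_def by blast
  have SA1: "S \<subseteq> A1"
    using Z0 S unfolding A1_def Z_def by blast
  have y1_inv: "y1 u = y1 v" if uv: "u \<in> carrier G" "v \<in> carrier G" "cls n' u = cls n' v" for u v
  proof (cases "u \<in> A")
    case True
    then have "v \<in> A" using saturatedD[OF A'] uv by blast
    moreover have "cls n u = cls n v" using cls_coarser[OF _ uv] n' by simp
    ultimately show ?thesis using coset_constantD[OF y(1) True uv(1,2)] True unfolding y1_def by simp
  next
    case False
    then have "v \<notin> A" using saturatedD[OF A'] uv by blast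
    then show ?thesis using False uv unfolding y1_def by simp
  qed
  have y1S: "y1 s = q s" if "s \<in> S" for s
    using that q the_inv_into_f_f[OF inj that] unfolding y1_def by simp
  have y1K: "y1 \<in> carrier G \<rightarrow> K"
  proof
    fix u assume "u \<in> carrier G"
    moreover have "the_inv_into S (cls n') (cls n' u) \<in> S" if "cls n' u \<in> cls n' ` S"
      using the_inv_into_into[OF inj that] by blast
    ultimately show "y1 u \<in> K" using y(2) a0 q(1) S(3) unfolding y1_def by auto
  qed
  have const: "coset_constant n' A1 y1"
    unfolding coset_constant_def A1_def using y1_inv mem_cls_iff by blast
  show ?thesis
  proof (intro exI[of _ n'] exI[of _ A1] exI[of _ y1] conjI ballI impI)
    fix c p assume c: "c \<in> carrier G" "p \<in> carrier G \<rightarrow> K" "\<forall>u\<in>A. p u = y u"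
    then obtain g where "g \<in> carrier G" "\<forall>f\<in>F. g \<otimes> f \<in> S \<and> q (g \<otimes> f) = p (c \<otimes> f)" using Sq by blast
    then show "\<exists>g\<in>carrier G. \<forall>f\<in>F. g \<otimes> f \<in> A1 \<and> y1 (g \<otimes> f) = p (c \<otimes> f)"
      using y1S SA1 by (intro bexI[of _ g]) auto
  next
    show "y1 u = y u" if "u \<in> A" for u using that unfolding y1_def by simp
  qed (use n' satA1 const y1K holes1 Z0 h AA1 SA1 S in auto)
qed

end


text \<open>The outcome of the construction: all that the proofs below use about \<open>x\<close>. The last assumption
  says that \<open>x\<close> shows every pattern which a filling of the holes of stage \<open>j\<close> could show in a
  translate of \<open>F j\<close>.\<close>

locale toeplitz_array = coset_tower G H for G (structure) and H +
  fixes k :: nat and \<kappa> :: real and x :: "'a \<Rightarrow> nat"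
    and r :: "nat \<Rightarrow> nat" and A F :: "nat \<Rightarrow> 'a set"
  assumes k: "k > 1"
    and x: "x \<in> carrier G \<rightarrow>\<^sub>E {1..k}"
    and r: "strict_mono r"
    and saturated_A: "saturated (r j) (A j)"
    and coset_constant_x: "coset_constant (r j) (A j) x"
    and many_holes: "\<kappa> * card (V (r j)) < card (holes (r j) (A j))"
    and few_holes: "card (holes (r j) (A j)) \<le> \<kappa> * card (V (r j)) + 1"
    and F_exhausts: "finite W \<Longrightarrow> W \<subseteq> carrier G \<Longrightarrow> \<exists>j0. \<forall>j\<ge>j0. W \<subseteq> F j"
    and F_A: "F j \<subseteq> A j"
    and patterns: "c \<in> carrier G \<Longrightarrow> p \<in> carrier G \<rightarrow> {1..k} \<Longrightarrow> \<forall>u\<in>A j. p u = x u \<Longrightarrow>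
      \<exists>g\<in>carrier G. \<forall>f\<in>F j. x (g \<otimes> f) = p (c \<otimes> f)"

text \<open>Iterates \<open>filling_step\<close> from the empty filling, whose proportion of holes is \<open>1 > \<kappa>\<close>; the windows
  \<open>F j\<close> are initial segments of an enumeration of the group. The sequences are shifted by one stage,
  since the starting stage need not satisfy the upper bound on the number of holes.\<close>

lemma (in coset_tower) ex_toeplitz_array:
  fixes \<kappa> :: real
  assumes cnt: "countable (carrier G)" and k: "k > 1" and \<kappa>: "0 \<le> \<kappa>" "\<kappa> < 1"
  shows "\<exists>x r A F. toeplitz_array G H k \<kappa> x r A F"
proof -
  let ?K = "{1..k}"
  define F where "F = (\<lambda>j. from_nat_into (carrier G) ` {..j})"
  have F: "finite (F j)" "F j \<subseteq> carrier G" for j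
    using from_nat_into[of "carrier G"] one_closed unfolding F_def by (auto intro: from_nat_into)
  have Fmono: "i \<le> j \<Longrightarrow> F i \<subseteq> F j" for i j unfolding F_def by auto
  have Fexh: "\<exists>j0. \<forall>j\<ge>j0. W \<subseteq> F j" if "finite W" "W \<subseteq> carrier G" for W
    using that
  proof (induction W rule: finite_induct)
    case (insert w W)
    then obtain j0 where j0: "\<forall>j\<ge>j0. W \<subseteq> F j" by auto
    obtain i where "from_nat_into (carrier G) i = w"
      using from_nat_into_surj[OF cnt, of w] insert.prems by auto
    then have "\<forall>j\<ge>max i j0. insert w W \<subseteq> F j" using j0 unfolding F_def by auto
    then show ?case by blast
  qed auto
  define P where "P = (\<lambda>(n, A, y). saturated n A \<and> coset_constant n A y \<and> y \<in> carrier G \<rightarrow> ?K \<and>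
     \<kappa> * card (V n) < card (holes n A))"
  define Q where "Q = (\<lambda>j (n, A, y) (n', A', y'). n < n' \<and>
     card (holes n' A') \<le> \<kappa> * card (V n') + 1 \<and>
     A \<subseteq> A' \<and> F j \<subseteq> A' \<and> (\<forall>u\<in>A. y' u = y u) \<and>
     (\<forall>c\<in>carrier G. \<forall>p\<in>carrier G \<rightarrow> ?K. (\<forall>u\<in>A. p u = y u) \<longrightarrow>
       (\<exists>g\<in>carrier G. \<forall>f\<in>F j. g \<otimes> f \<in> A' \<and> y' (g \<otimes> f) = p (c \<otimes> f))))"
  have "\<exists>s. \<forall>j. P (s j) \<and> Q j (s j) (s (Suc j))"
  proof (rule dependent_nat_choice)
    show "\<exists>s. P s"
      using \<kappa> card_V_pos[of 0] k
      by (intro exI[of _ "(0, {}, \<lambda>_. 1)"])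
        (auto simp: P_def saturated_empty holes_empty coset_constant_def)
  next
    fix s j assume "P s"
    moreover obtain n A y where s: "s = (n, A, y)" by (cases s)
    ultimately have P: "saturated n A" "coset_constant n A y" "y \<in> carrier G \<rightarrow> ?K"
      "\<kappa> * card (V n) < card (holes n A)" unfolding P_def by auto
    have "?K \<noteq> {}" using k by auto
    from filling_step[OF F[of j] finite_atLeastAtMost this \<kappa>(1) P]
    obtain n' A' y' where "n < n'" "saturated n' A'" "coset_constant n' A' y'" "y' \<in> carrier G \<rightarrow> ?K"
     "\<kappa> * card (V n') < card (holes n' A')" "card (holes n' A') \<le> \<kappa> * card (V n') + 1"
     "A \<subseteq> A'" "F j \<subseteq> A'" "\<forall>u\<in>A. y' u = y u"
     "\<forall>c\<in>carrier G. \<forall>p\<in>carrier G \<rightarrow> ?K. (\<forall>u\<in>A. p u = y u) \<longrightarrow>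
       (\<exists>g\<in>carrier G. \<forall>f\<in>F j. g \<otimes> f \<in> A' \<and> y' (g \<otimes> f) = p (c \<otimes> f))"
      by (elim exE conjE) (rule that)
    then show "\<exists>s'. P s' \<and> Q j s s'"
      unfolding s by (intro exI[of _ "(n', A', y')"]) (simp add: P_def Q_def)
  qed
  then obtain s where s: "\<And>j. P (s j)" "\<And>j. Q j (s j) (s (Suc j))" by blast
  define n where "n = (\<lambda>j. fst (s j))"
  define A where "A = (\<lambda>j. fst (snd (s j)))"
  define y where "y = (\<lambda>j. snd (snd (s j)))"
  have seq: "s j = (n j, A j, y j)" for j by (simp add: n_def A_def y_def)
  have P: "saturated (n j) (A j)" "coset_constant (n j) (A j) (y j)" "y j \<in> carrier G \<rightarrow> ?K"
    "\<kappa> * card (V (n j)) < card (holes (n j) (A j))" for j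
    using s(1)[of j] unfolding seq P_def by auto
  have Q: "n j < n (Suc j)" "card (holes (n (Suc j)) (A (Suc j))) \<le> \<kappa> * card (V (n (Suc j))) + 1"
    "A j \<subseteq> A (Suc j)" "F j \<subseteq> A (Suc j)" "\<And>u. u \<in> A j \<Longrightarrow> y (Suc j) u = y j u" for j
    using s(2)[of j] unfolding seq Q_def by auto
  have Qp: "\<exists>g\<in>carrier G. \<forall>f\<in>F j. g \<otimes> f \<in> A (Suc j) \<and> y (Suc j) (g \<otimes> f) = p (c \<otimes> f)"
    if "c \<in> carrier G" "p \<in> carrier G \<rightarrow> ?K" "\<forall>u\<in>A j. p u = y j u" for j c p
    using s(2)[of j] that unfolding seq Q_def by auto
  have Amono: "i \<le> j \<Longrightarrow> A i \<subseteq> A j" for i j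
    using lift_Suc_mono_le[of A, OF Q(3)] by blast
  have yA: "y j u = y i u" if "u \<in> A i" "i \<le> j" for i j u
    using that(2,1)
  proof (induction j rule: dec_induct)
    case (step j)
    then show ?case using Q(5)[of u j] Amono[of i j] by auto
  qed simp
  have AG: "A j \<subseteq> carrier G" for j using P(1)[of j] unfolding saturated_def by blast
  define x where "x = (\<lambda>u\<in>carrier G. y (LEAST j. u \<in> A j) u)"
  have xy: "x u = y j u" if "u \<in> A j" for u j
  proof -
    let ?i = "LEAST j. u \<in> A j"
    have "u \<in> A ?i" "?i \<le> j" using that by (auto intro: LeastI Least_le)
    then show ?thesis using yA[of u ?i j] AG that unfolding x_def by auto
  qed
  have "toeplitz_array G H k \<kappa> x (\<lambda>j. n (Suc j)) (\<lambda>j. A (Suc j)) F"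
  proof (unfold_locales)
    show "x \<in> carrier G \<rightarrow>\<^sub>E ?K" using P(3) unfolding x_def by auto
    show "strict_mono (\<lambda>j. n (Suc j))" using Q(1) by (simp add: strict_mono_Suc_iff)
    show "coset_constant (n (Suc j)) (A (Suc j)) x" for j
      unfolding coset_constant_def
    proof (intro ballI)
      fix a b assume ab: "a \<in> A (Suc j)" "b \<in> cls (n (Suc j)) a"
      then have "b \<in> A (Suc j)" using P(1)[of "Suc j"] unfolding saturated_def by auto
      moreover have "y (Suc j) b = y (Suc j) a"
        using P(2)[of "Suc j"] ab unfolding coset_constant_def by auto
      ultimately show "x b = x a" using xy[of _ "Suc j"] ab by simp
    qed
    show "\<exists>g\<in>carrier G. \<forall>f\<in>F j. x (g \<otimes> f) = p (c \<otimes> f)"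
      if c: "c \<in> carrier G" and p: "p \<in> carrier G \<rightarrow> ?K" "\<forall>u\<in>A (Suc j). p u = x u" for c p j
    proof -
      have "\<forall>u\<in>A (Suc j). p u = y (Suc j) u" using p(2) xy[of _ "Suc j"] by simp
      from Qp[OF c p(1) this] obtain g where g: "g \<in> carrier G"
        "\<forall>f\<in>F (Suc j). g \<otimes> f \<in> A (Suc (Suc j)) \<and> y (Suc (Suc j)) (g \<otimes> f) = p (c \<otimes> f)" by blast
      have "x (g \<otimes> f) = p (c \<otimes> f)" if "f \<in> F j" for f
        using xy[of "g \<otimes> f" "Suc (Suc j)"] g(2) that Fmono[of j "Suc j"] by auto
      then show ?thesis using g by blast
    qed
  qed (use k \<kappa> P Q Fexh in auto)
  then show ?thesis by blast
qed

context toeplitz_array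
begin

lemma x_in: "u \<in> carrier G \<Longrightarrow> x u \<in> {1..k}"
  using x by auto

lemma toeplitz_x: "toeplitz G k x"
  unfolding toeplitz_def
proof (intro conjI exI[of _ "\<lambda>j. H (r j)"] allI)
  show "x \<in> topspace (full_shift G k)" using x by (simp add: full_shift_def)
  show "finite_index_subgroup G (H (r j))" for j
    unfolding finite_index_subgroup_def using subgroup_H finite_V by auto
  show "H (r (Suc j)) \<subseteq> H (r j)" for j
    using H_antimono r by (simp add: strict_mono_less_eq)
  have A_Per: "A j \<subseteq> Per G (H (r j)) x" for j
  proof
    fix a assume a: "a \<in> A j"
    have aG: "a \<in> carrier G" using a saturated_A[of j] unfolding saturated_def by auto
    have "x (inv h \<otimes> a) = x a" if h: "h \<in> H (r j)" for h
    proof -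
      have h': "inv h \<in> H (r j)" using subgroup.m_inv_closed[OF subgroup_H h] .
      then have "cls (r j) a = cls (r j) (inv h \<otimes> a)" using cls_H_mult aG by simp
      then show ?thesis
        using coset_constantD[OF coset_constant_x a aG, of "inv h \<otimes> a"] aG H_carrier[OF h'] by simp
    qed
    then show "a \<in> Per G (H (r j)) x" using aG unfolding Per_def by auto
  qed
  show "carrier G = (\<Union>j. Per G (H (r j)) x)"
  proof (intro equalityI subsetI)
    fix u assume u: "u \<in> carrier G"
    obtain j where "{u} \<subseteq> F j" using F_exhausts[of "{u}"] u by auto
    then have "u \<in> Per G (H (r j)) x" using F_A[of j] A_Per[of j] by auto
    then show "u \<in> (\<Union>j. Per G (H (r j)) x)" by auto
  qed (auto simp: Per_def)
qed

end


section \<open>Subshifts with a dynamically generating pseudometric\<close>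

lemma topspace_full_shift: "topspace (full_shift G k) = carrier G \<rightarrow>\<^sub>E {1..k}"
  by (simp add: full_shift_def)

text \<open>The sets of points with prescribed values on a finite window form a base of the topology; this and
  the next lemma are the two halves of that statement in the form used here.\<close>

lemma openin_cylinder:
  assumes "finite W" "W \<subseteq> carrier G" "y \<in> carrier G \<rightarrow>\<^sub>E {1..k}"
  shows "openin (full_shift G k) {z \<in> carrier G \<rightarrow>\<^sub>E {1..k}. \<forall>w\<in>W. z w = y w}"
  using assms(1,2)
proof (induction W rule: finite_induct)
  case empty
  show ?case using openin_topspace[of "full_shift G k"] by (simp add: topspace_full_shift)
next
  case (insert w W)
  have "continuous_map (full_shift G k) (discrete_topology {1..k}) (\<lambda>z. z w)"
    unfolding full_shift_def using insert.prems by (intro continuous_map_product_projection) auto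
  moreover have "openin (discrete_topology {1..k}) {y w}" using assms(3) insert.prems by auto
  ultimately have "openin (full_shift G k) {z \<in> topspace (full_shift G k). z w \<in> {y w}}"
    by (rule openin_continuous_map_preimage)
  moreover have "openin (full_shift G k) {z \<in> carrier G \<rightarrow>\<^sub>E {1..k}. \<forall>w\<in>W. z w = y w}"
    using insert by auto
  ultimately have "openin (full_shift G k) ({z \<in> topspace (full_shift G k). z w \<in> {y w}} \<inter>
      {z \<in> carrier G \<rightarrow>\<^sub>E {1..k}. \<forall>w\<in>W. z w = y w})" by (rule openin_Int)
  also have "{z \<in> topspace (full_shift G k). z w \<in> {y w}} \<inter>
      {z \<in> carrier G \<rightarrow>\<^sub>E {1..k}. \<forall>w\<in>W. z w = y w} = {z \<in> carrier G \<rightarrow>\<^sub>E {1..k}. \<forall>w\<in>insert w W. z w = y w}"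
    unfolding topspace_full_shift by blast
  finally show ?case .
qed

lemma cylinder_neighbourhood:
  assumes "openin (full_shift G k) U" "y \<in> U"
  shows "\<exists>W. finite W \<and> W \<subseteq> carrier G \<and> (\<forall>z\<in>carrier G \<rightarrow>\<^sub>E {1..k}. (\<forall>w\<in>W. z w = y w) \<longrightarrow> z \<in> U)"
proof -
  from assms(1)[unfolded full_shift_def openin_product_topology_alt topspace_discrete_topology, rule_format, OF assms(2)]
  obtain B where B: "finite {i \<in> carrier G. B i \<noteq> {1..k}}" "y \<in> Pi\<^sub>E (carrier G) B" "Pi\<^sub>E (carrier G) B \<subseteq> U"
    by (elim exE conjE) (rule that)
  let ?W = "{i \<in> carrier G. B i \<noteq> {1..k}}"
  have "z \<in> U" if z: "z \<in> carrier G \<rightarrow>\<^sub>E {1..k}" "\<forall>w\<in>?W. z w = y w" for z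
  proof -
    have "z i \<in> B i" if i: "i \<in> carrier G" for i
    proof (cases "i \<in> ?W")
      case True
      then have "z i = y i" using z(2) by simp
      then show ?thesis using PiE_mem[OF B(2) i] by simp
    next
      case False
      then have "B i = {1..k}" using i by simp
      then show ?thesis using PiE_mem[OF z(1) i] by simp
    qed
    then have "z \<in> Pi\<^sub>E (carrier G) B" using z(1) by (auto simp: PiE_iff)
    then show ?thesis using B(3) by blast
  qed
  then show ?thesis using B(1) by (intro exI[of _ ?W]) auto
qed

lemma compact_full_shift: "compact_space (full_shift G k)"
  unfolding full_shift_def by (intro compact_space_product_topology[THEN iffD2] disjI2)
    (simp add: compact_space_discrete_topology)

lemma (in group) shift_in_full:
  assumes "s \<in> carrier G" "y \<in> carrier G \<rightarrow>\<^sub>E {1..k}"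
  shows "shift G s y \<in> carrier G \<rightarrow>\<^sub>E {1..k}"
  using assms unfolding shift_def by auto

lemma (in group) shift_apply: "h \<in> carrier G \<Longrightarrow> shift G s y h = y (inv s \<otimes> h)"
  by (simp add: shift_def)

lemma (in group) shift_shift:
  assumes "s \<in> carrier G" "t \<in> carrier G"
  shows "shift G s (shift G t y) = shift G (s \<otimes> t) y"
  using assms unfolding shift_def by (auto simp: inv_mult_group m_assoc intro!: restrict_ext)

lemma (in group) continuous_shift:
  assumes "s \<in> carrier G"
  shows "continuous_map (full_shift G k) (full_shift G k) (shift G s)"
  unfolding full_shift_def continuous_map_componentwise
proof (intro conjI ballI)
  show "shift G s ` topspace (product_topology (\<lambda>_. discrete_topology {1..k}) (carrier G)) \<subseteq> extensional (carrier G)"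
    by (auto simp: shift_def)
  fix h assume h: "h \<in> carrier G"
  have "continuous_map (product_topology (\<lambda>_. discrete_topology {1..k}) (carrier G))
     (discrete_topology {1..k}) (\<lambda>y. y (inv s \<otimes> h))"
    using assms h by (intro continuous_map_product_projection) auto
  then show "continuous_map (product_topology (\<lambda>_. discrete_topology {1..k}) (carrier G))
     (discrete_topology {1..k}) (\<lambda>y. shift G s y h)"
    using h by (simp add: shift_apply)
qed

locale subshift = group G for G (structure) +
  fixes k :: nat and Y :: "('a \<Rightarrow> nat) set"
    and d :: "('a \<Rightarrow> nat) \<Rightarrow> ('a \<Rightarrow> nat) \<Rightarrow> real"
  assumes closed_Y: "closedin (full_shift G k) Y"
    and shift_Y: "s \<in> carrier G \<Longrightarrow> y \<in> Y \<Longrightarrow> shift G s y \<in> Y"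
    and dyn_gen_d: "dyn_gen_pseudometric G (subtopology (full_shift G k) Y) (shift G) d"
begin

definition X :: "('a \<Rightarrow> nat) topology" where
  "X = subtopology (full_shift G k) Y"

lemmas d = dyn_gen_d[folded X_def]

lemma Y_subset: "Y \<subseteq> carrier G \<rightarrow>\<^sub>E {1..k}"
  using closedin_subset[OF closed_Y] by (simp add: topspace_full_shift)

lemma topspace_X: "topspace X = Y"
  using Y_subset by (auto simp: X_def topspace_full_shift)

lemma compact_X: "compact_space X"
  unfolding X_def
  using closedin_compact_space[OF compact_full_shift closed_Y] compact_space_subtopology by blast

lemma continuous_shift_X: "s \<in> carrier G \<Longrightarrow> continuous_map X X (shift G s)"
  unfolding X_def
  using continuous_shift[of s k] shift_Y
  by (auto simp: continuous_map_in_subtopology continuous_map_from_subtopology)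

lemma d_refl: "y \<in> Y \<Longrightarrow> d y y = 0"
  and d_nonneg: "y \<in> Y \<Longrightarrow> z \<in> Y \<Longrightarrow> 0 \<le> d y z"
  and d_sym: "y \<in> Y \<Longrightarrow> z \<in> Y \<Longrightarrow> d y z = d z y"
  and d_triangle: "y \<in> Y \<Longrightarrow> z \<in> Y \<Longrightarrow> w \<in> Y \<Longrightarrow> d y w \<le> d y z + d z w"
  and d_generating: "y \<in> Y \<Longrightarrow> z \<in> Y \<Longrightarrow> y \<noteq> z \<Longrightarrow> \<exists>s\<in>carrier G. d (shift G s y) (shift G s z) > 0"
  using d unfolding dyn_gen_pseudometric_def topspace_X by auto

lemma continuous_d: "continuous_map (prod_topology X X) euclideanreal (\<lambda>p. d (fst p) (snd p))"
proof -
  have "(\<lambda>p. d (fst p) (snd p)) = (\<lambda>(x, y). d x y)" by auto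
  then show ?thesis using d unfolding dyn_gen_pseudometric_def by simp
qed

lemma openin_cylinder_X:
  assumes "finite W" "W \<subseteq> carrier G" "y \<in> Y"
  shows "openin X {z \<in> Y. \<forall>w\<in>W. z w = y w}"
proof -
  have "openin (full_shift G k) {z \<in> carrier G \<rightarrow>\<^sub>E {1..k}. \<forall>w\<in>W. z w = y w}"
    using openin_cylinder[OF assms(1,2)] assms(3) Y_subset by blast
  moreover have "{z \<in> Y. \<forall>w\<in>W. z w = y w} = {z \<in> carrier G \<rightarrow>\<^sub>E {1..k}. \<forall>w\<in>W. z w = y w} \<inter> Y"
    using Y_subset by blast
  ultimately show ?thesis unfolding X_def openin_subtopology by blast
qed

lemma cylinder_neighbourhood_X:
  assumes "openin X U" "y \<in> U"
  shows "\<exists>W. finite W \<and> W \<subseteq> carrier G \<and> (\<forall>z\<in>Y. (\<forall>w\<in>W. z w = y w) \<longrightarrow> z \<in> U)"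
proof -
  obtain T where T: "openin (full_shift G k) T" "U = T \<inter> Y"
    using assms(1) unfolding X_def openin_subtopology by blast
  obtain W where W: "finite W" "W \<subseteq> carrier G"
    "\<forall>z\<in>carrier G \<rightarrow>\<^sub>E {1..k}. (\<forall>w\<in>W. z w = y w) \<longrightarrow> z \<in> T"
    using cylinder_neighbourhood[OF T(1), of y] assms(2) T(2) by blast
  have "\<forall>z\<in>Y. (\<forall>w\<in>W. z w = y w) \<longrightarrow> z \<in> U" using W(3) T(2) Y_subset by blast
  then show ?thesis using W by blast
qed

lemma openin_d_greater:
  assumes "s \<in> carrier G"
  shows "openin (prod_topology X X) {p \<in> Y \<times> Y. d (shift G s (fst p)) (shift G s (snd p)) > c}"
proof -
  have "continuous_map (prod_topology X X) (prod_topology X X) (\<lambda>p. (shift G s (fst p), shift G s (snd p)))"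
    using continuous_map_compose[OF continuous_map_fst continuous_shift_X[OF assms], of X]
      continuous_map_compose[OF continuous_map_snd continuous_shift_X[OF assms], of X]
    by (intro continuous_map_pairedI) (simp_all add: comp_def)
  from continuous_map_compose[OF this continuous_d]
  have "continuous_map (prod_topology X X) euclideanreal (\<lambda>p. d (shift G s (fst p)) (shift G s (snd p)))"
    by (simp add: comp_def)
  from openin_continuous_map_preimage[OF this, of "{c<..}"]
  show ?thesis by (simp add: topspace_X)
qed

text \<open>Every point has a cylinder neighbourhood of \<open>d\<close>-diameter less than \<open>e\<close>; finitely many of these
  cover the compact space, and the union of their windows works.\<close>

lemma agree_imp_close:
  assumes e: "e > 0"
  shows "\<exists>W. finite W \<and> W \<subseteq> carrier G \<and> (\<forall>u\<in>Y. \<forall>v\<in>Y. (\<forall>w\<in>W. u w = v w) \<longrightarrow> d u v < e)"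
proof -
  let ?S = "{p \<in> Y \<times> Y. d (fst p) (snd p) < e}"
  have S: "openin (prod_topology X X) ?S"
    using openin_continuous_map_preimage[OF continuous_d, of "{..<e}"] by (simp add: topspace_X)
  have "\<exists>W. finite W \<and> W \<subseteq> carrier G \<and>
      (\<forall>u\<in>Y. \<forall>v\<in>Y. (\<forall>w\<in>W. u w = y w) \<and> (\<forall>w\<in>W. v w = y w) \<longrightarrow> d u v < e)" if y: "y \<in> Y" for y
  proof -
    have "(y, y) \<in> ?S" using y e d_refl by auto
    from S[unfolded openin_prod_topology_alt, rule_format, OF this]
    obtain U U' where U: "openin X U" "openin X U'" "y \<in> U" "y \<in> U'" "U \<times> U' \<subseteq> ?S"
      by (elim exE conjE) (rule that)
    obtain W where W: "finite W" "W \<subseteq> carrier G" "\<forall>z\<in>Y. (\<forall>w\<in>W. z w = y w) \<longrightarrow> z \<in> U \<inter> U'"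
      using cylinder_neighbourhood_X[of "U \<inter> U'" y] U by blast
    have "d u v < e" if "u \<in> Y" "v \<in> Y" "\<forall>w\<in>W. u w = y w" "\<forall>w\<in>W. v w = y w" for u v
    proof -
      have "(u, v) \<in> U \<times> U'" using W(3) that by blast
      then show ?thesis using U(5) by auto
    qed
    then show ?thesis using W by blast
  qed
  then obtain W where W: "\<And>y. y \<in> Y \<Longrightarrow> finite (W y)" "\<And>y. y \<in> Y \<Longrightarrow> W y \<subseteq> carrier G"
    "\<And>y u v. y \<in> Y \<Longrightarrow> u \<in> Y \<Longrightarrow> v \<in> Y \<Longrightarrow> \<forall>w\<in>W y. u w = y w \<Longrightarrow> \<forall>w\<in>W y. v w = y w \<Longrightarrow> d u v < e"
    by metis
  let ?C = "\<lambda>y. {z \<in> Y. \<forall>w\<in>W y. z w = y w}"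
  have "\<And>U. U \<in> ?C ` Y \<Longrightarrow> openin X U" using openin_cylinder_X W by blast
  moreover have "topspace X \<subseteq> \<Union>(?C ` Y)" unfolding topspace_X by blast
  ultimately obtain \<F> where \<F>: "finite \<F>" "\<F> \<subseteq> ?C ` Y" "topspace X \<subseteq> \<Union>\<F>"
    using compact_X unfolding compact_space_alt by meson
  obtain Y0 where Y0: "finite Y0" "Y0 \<subseteq> Y" "\<F> = ?C ` Y0"
    using finite_subset_image[OF \<F>(1,2)] by blast
  let ?W = "\<Union>y\<in>Y0. W y"
  have "d u v < e" if uv: "u \<in> Y" "v \<in> Y" "\<forall>w\<in>?W. u w = v w" for u v
  proof -
    obtain y where y: "y \<in> Y0" "u \<in> ?C y" using \<F>(3) uv(1) Y0(3) unfolding topspace_X by blast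
    then show ?thesis using W(3)[of y u v] uv Y0(2) by auto
  qed
  moreover have "finite ?W" "?W \<subseteq> carrier G" using Y0 W(1,2) by blast+
  ultimately show ?thesis by blast
qed

text \<open>The pairs of points that differ at \<open>\<one>\<close> form a compact set, covered by the open sets
  on which a given translation separates the pair by more than a given amount.\<close>

lemma origin_separation:
  "\<exists>e S. e > 0 \<and> finite S \<and> S \<subseteq> carrier G \<and>
     (\<forall>u\<in>Y. \<forall>v\<in>Y. u \<one> \<noteq> v \<one> \<longrightarrow> (\<exists>s\<in>S. d (shift G s u) (shift G s v) > e))"
proof -
  let ?C = "\<lambda>y. {z \<in> Y. \<forall>w\<in>{\<one>}. z w = y w}"
  (* the pairs that agree at the neutral element; adding this open set makes the cover one of the whole product *)
  define E where "E = (\<Union>y\<in>Y. ?C y \<times> ?C y)"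
  define U where "U = (\<lambda>(s, i::nat). {p \<in> Y \<times> Y. d (shift G s (fst p)) (shift G s (snd p)) > 1 / (real i + 1)})"
  let ?\<U> = "insert E (U ` (carrier G \<times> UNIV))"
  have "openin (prod_topology X X) E"
    unfolding E_def using openin_cylinder_X[of "{\<one>}"]
    by (intro openin_Union) (auto simp: openin_prod_Times_iff)
  then have op: "\<And>U. U \<in> ?\<U> \<Longrightarrow> openin (prod_topology X X) U"
    using openin_d_greater unfolding U_def by auto
  have cov: "topspace (prod_topology X X) \<subseteq> \<Union>?\<U>"
  proof
    fix p assume "p \<in> topspace (prod_topology X X)"
    then obtain u v where p: "p = (u, v)" "u \<in> Y" "v \<in> Y" by (auto simp: topspace_X)
    show "p \<in> \<Union>?\<U>"
    proof (cases "u = v")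
      case True
      then have "p \<in> E" using p unfolding E_def by auto
      then show ?thesis by blast
    next
      case False
      then obtain s where s: "s \<in> carrier G" "d (shift G s u) (shift G s v) > 0"
        using d_generating p by blast
      then obtain i where "inverse (real (Suc i)) < d (shift G s u) (shift G s v)"
        using reals_Archimedean by blast
      then have "p \<in> U (s, i)" using p unfolding U_def by (simp add: inverse_eq_divide add.commute)
      then show ?thesis using s(1) by (intro UnionI[of "U (s, i)"]) auto
    qed
  qed
  have "compact_space (prod_topology X X)" using compact_X by (simp add: compact_space_prod_topology)
  then obtain \<F> where \<F>: "finite \<F>" "\<F> \<subseteq> ?\<U>" "topspace (prod_topology X X) \<subseteq> \<Union>\<F>"
    using op cov unfolding compact_space_alt by meson
  have "finite (\<F> - {E})" "\<F> - {E} \<subseteq> U ` (carrier G \<times> UNIV)" using \<F> by auto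
  from finite_subset_image[OF this]
  obtain I where I: "finite I" "I \<subseteq> carrier G \<times> UNIV" "\<F> - {E} = U ` I" by blast
  define m where "m = Max (insert 0 (snd ` I))"
  have "\<exists>s\<in>fst ` I. d (shift G s u) (shift G s v) > 1 / (real m + 1)"
    if uv: "u \<in> Y" "v \<in> Y" "u \<one> \<noteq> v \<one>" for u v
  proof -
    have "(u, v) \<notin> E" using uv(3) unfolding E_def by auto
    moreover have "(u, v) \<in> \<Union>\<F>" using \<F>(3) uv by (auto simp: topspace_X)
    ultimately have "(u, v) \<in> \<Union>(U ` I)" using I(3) by blast
    then obtain s i where si: "(s, i) \<in> I" "(u, v) \<in> U (s, i)" by auto
    have "i \<le> m" unfolding m_def using si(1) I(1) by (intro Max_ge) (auto intro: rev_image_eqI)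
    then have "1 / (real m + 1) \<le> 1 / (real i + 1)" by (simp add: frac_le)
    also have "\<dots> < d (shift G s u) (shift G s v)" using si(2) unfolding U_def by simp
    finally show ?thesis using si(1) by (force intro: rev_bexI)
  qed
  moreover have "finite (fst ` I)" "fst ` I \<subseteq> carrier G" using I by auto
  ultimately show ?thesis by (intro exI[of _ "1 / (real m + 1)"] exI[of _ "fst ` I"]) auto
qed

end

context toeplitz_array
begin

definition orbit_cl :: "('a \<Rightarrow> nat) set" where
  "orbit_cl = full_shift G k closure_of ((\<lambda>g. shift G g x) ` carrier G)"

lemma orbit_closure_eq: "orbit_closure G k x = subtopology (full_shift G k) orbit_cl"
  by (simp add: orbit_closure_def orbit_cl_def)

lemma orbit_in_full: "(\<lambda>g. shift G g x) ` carrier G \<subseteq> carrier G \<rightarrow>\<^sub>E {1..k}"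
  by (intro image_subsetI shift_in_full x)

lemma orbit_subset: "(\<lambda>g. shift G g x) ` carrier G \<subseteq> orbit_cl"
  unfolding orbit_cl_def using orbit_in_full closure_of_subset topspace_full_shift by metis

lemma closed_orbit_cl: "closedin (full_shift G k) orbit_cl"
  unfolding orbit_cl_def by simp

lemma shift_orbit_cl:
  assumes "s \<in> carrier G" "y \<in> orbit_cl"
  shows "shift G s y \<in> orbit_cl"
proof -
  let ?O = "(\<lambda>g. shift G g x) ` carrier G"
  have "shift G s ` orbit_cl \<subseteq> (full_shift G k closure_of (shift G s ` ?O))"
    unfolding orbit_cl_def using continuous_map_image_closure_subset[OF continuous_shift[OF assms(1)]] .
  also have "shift G s ` ?O \<subseteq> ?O" using assms(1) shift_shift by auto
  then have "(full_shift G k closure_of (shift G s ` ?O)) \<subseteq> orbit_cl"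
    unfolding orbit_cl_def by (rule closure_of_mono)
  finally show ?thesis using assms(2) by blast
qed

text \<open>Finite patterns of points of the orbit closure occur in \<open>x\<close> itself.\<close>

lemma orbit_cl_pattern:
  assumes "y \<in> orbit_cl" "finite W" "W \<subseteq> carrier G"
  shows "\<exists>g\<in>carrier G. \<forall>w\<in>W. y w = x (g \<otimes> w)"
proof -
  have y: "y \<in> carrier G \<rightarrow>\<^sub>E {1..k}"
    using assms(1) closedin_subset[OF closed_orbit_cl] unfolding topspace_full_shift by (rule rev_subsetD)
  let ?C = "{z \<in> carrier G \<rightarrow>\<^sub>E {1..k}. \<forall>w\<in>W. z w = y w}"
  have "openin (full_shift G k) ?C" "y \<in> ?C" using openin_cylinder[OF assms(2,3) y] y by auto
  moreover have "\<forall>T. y \<in> T \<and> openin (full_shift G k) T \<longrightarrow> (\<exists>z. z \<in> (\<lambda>g. shift G g x) ` carrier G \<and> z \<in> T)"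
    using assms(1) unfolding orbit_cl_def in_closure_of by (rule conjunct2)
  ultimately have "\<exists>z. z \<in> (\<lambda>g. shift G g x) ` carrier G \<and> z \<in> ?C" by (elim allE[of _ ?C]) simp
  then obtain g where g: "g \<in> carrier G" "shift G g x \<in> ?C" by (elim exE conjE imageE) simp
  have "y w = x (inv g \<otimes> w)" if "w \<in> W" for w
  proof -
    have "shift G g x w = y w" using g(2) that by blast
    moreover have "shift G g x w = x (inv g \<otimes> w)" using that assms(3) by (intro shift_apply) auto
    ultimately show ?thesis by simp
  qed
  then show ?thesis using g(1) by (intro bexI[of _ "inv g"]) auto
qed

lemma ex_dyn_gen_pseudometric:
  assumes "countable (carrier G)"
  shows "\<exists>d. dyn_gen_pseudometric G (orbit_closure G k x) (shift G) d"
proof (rule metrizable_imp_dyn_gen_pseudometric)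
  show "group G" ..
  have "metrizable_space (full_shift G k)"
    unfolding full_shift_def metrizable_space_product_topology
    using assms by (auto simp: metrizable_space_discrete_topology intro: countable_subset)
  then show "metrizable_space (orbit_closure G k x)"
    unfolding orbit_closure_eq by (rule metrizable_space_subtopology)
  fix y assume "y \<in> topspace (orbit_closure G k x)"
  then have "y \<in> carrier G \<rightarrow>\<^sub>E {1..k}" by (simp add: orbit_closure_eq topspace_full_shift)
  then show "shift G \<one> y = y" by (intro extensionalityI[of _ "carrier G"]) (auto simp: shift_def PiE_iff)
qed

end


section \<open>Counting\<close>

lemma sep_number_le:
  assumes "\<And>S. finite S \<Longrightarrow> S \<subseteq> Y \<Longrightarrow> (\<forall>x\<in>S. \<forall>y\<in>S. x \<noteq> y \<longrightarrow> \<rho> x y > \<epsilon>) \<Longrightarrow> card S \<le> K"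
  shows "sep_number \<epsilon> Y \<rho> \<le> enat K"
  unfolding sep_number_def by (rule SUP_least) (use assms in auto)

lemma le_sep_number:
  assumes "finite S" "S \<subseteq> Y" "\<And>x y. x \<in> S \<Longrightarrow> y \<in> S \<Longrightarrow> x \<noteq> y \<Longrightarrow> \<rho> x y > \<epsilon>"
  shows "enat (card S) \<le> sep_number \<epsilon> Y \<rho>"
  unfolding sep_number_def by (rule SUP_upper) (use assms in auto)

lemma log_enat_le:
  assumes "m \<le> enat K" "ln (real K) \<le> a" "K > 0"
  shows "log_enat m \<le> ereal a"
proof (cases m)
  case (enat i)
  have "ln (real i) \<le> a" if "i > 0"
  proof -
    have "ln (real i) \<le> ln (real K)" using enat assms(1,3) that by simp
    then show ?thesis using assms(2) by (rule order_trans)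
  qed
  then show ?thesis using enat by (auto simp: log_enat_def)
qed (use assms in auto)

lemma le_log_enat:
  assumes "enat K \<le> m" "a \<le> ln (real K)" "K > 0"
  shows "ereal a \<le> log_enat m"
proof (cases m)
  case (enat i)
  then have "i > 0" "ln (real K) \<le> ln (real i)" using assms by auto
  then have "i > 0" "a \<le> ln (real i)" using order_trans[OF assms(2)] by blast+
  then show ?thesis using enat by (auto simp: log_enat_def)
qed (auto simp: log_enat_def)

text \<open>Labellings of a set in which only a small proportion of the points gets a label number at most
  \<open>exp (\<tau> * card V)\<close>. Giving every labelled point the weight \<open>z \<le> 1\<close>, the total weight of all
  labellings is \<open>(1 + card L * z) ^ card V\<close>, whereas each sparse one weighs at least
  \<open>z powr (\<eta> * card V)\<close>; choosing first \<open>z\<close> and then \<open>\<eta>\<close> small gives the bound.\<close>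

lemma sparse_labellings:
  fixes \<tau> :: real and L :: "'l set"
  assumes "\<tau> > 0" and L: "finite L"
  shows "\<exists>\<eta>::real. \<eta> > 0 \<and> (\<forall>V :: 'v set. finite V \<longrightarrow>
    card {\<psi> \<in> V \<rightarrow>\<^sub>E insert None (Some ` L). card {v\<in>V. \<psi> v \<noteq> None} \<le> \<eta> * card V} \<le> exp (\<tau> * card V))"
proof -
  define z where "z = min 1 (\<tau> / (2 * (card L + 1)))"
  have z: "0 < z" "z \<le> 1" using assms by (auto simp: z_def)
  have "card L * z \<le> card L * (\<tau> / (2 * (card L + 1)))"
    unfolding z_def by (intro mult_left_mono) auto
  also have "\<dots> \<le> \<tau> / 2" using assms by (simp add: field_simps)
  finally have Lz: "card L * z \<le> \<tau> / 2" .
  define \<eta> where "\<eta> = \<tau> / (2 * (ln (1 / z) + 1))"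
  have lnz: "ln (1 / z) \<ge> 0" using z by (simp add: ln_div)
  then have \<eta>: "\<eta> > 0" using assms by (simp add: \<eta>_def)
  have "\<eta> * ln (1 / z) \<le> \<eta> * (ln (1 / z) + 1)" using \<eta> by (simp add: distrib_left)
  also have "\<dots> = \<tau> / 2" using lnz unfolding \<eta>_def by (simp add: field_simps)
  finally have \<eta>z: "\<eta> * ln (1 / z) \<le> \<tau> / 2" .
  have "card {\<psi> \<in> V \<rightarrow>\<^sub>E insert None (Some ` L). card {v\<in>V. \<psi> v \<noteq> None} \<le> \<eta> * card V} \<le> exp (\<tau> * card V)"
    if V: "finite V" for V :: "'v set"
  proof -
    let ?All = "V \<rightarrow>\<^sub>E insert None (Some ` L)"
    let ?Sp = "{\<psi> \<in> ?All. card {v\<in>V. \<psi> v \<noteq> None} \<le> \<eta> * card V}"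
    define wt :: "'l option \<Rightarrow> real" where "wt = (\<lambda>l. if l = None then 1 else z)"
    have fin: "finite ?All" using V L by (intro finite_PiE) auto
    have prod_wt: "(\<Prod>v\<in>V. wt (\<psi> v)) = z ^ card {v\<in>V. \<psi> v \<noteq> None}" for \<psi>
    proof -
      have "(\<Prod>v\<in>V. wt (\<psi> v)) = (\<Prod>v\<in>V. if \<psi> v \<noteq> None then z else 1)"
        unfolding wt_def by (intro prod.cong) auto
      also have "\<dots> = (\<Prod>v\<in>{v\<in>V. \<psi> v \<noteq> None}. z)"
        using V by (rule prod.inter_filter[symmetric])
      finally show ?thesis by simp
    qed
    have "card ?Sp * z powr (\<eta> * card V) = (\<Sum>\<psi>\<in>?Sp. z powr (\<eta> * card V))" by simp
    also have "\<dots> \<le> (\<Sum>\<psi>\<in>?Sp. \<Prod>v\<in>V. wt (\<psi> v))"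
    proof (rule sum_mono)
      fix \<psi> assume "\<psi> \<in> ?Sp"
      then have "card {v\<in>V. \<psi> v \<noteq> None} \<le> \<eta> * card V" by simp
      then have "z powr (\<eta> * card V) \<le> z powr card {v\<in>V. \<psi> v \<noteq> None}"
        using z by (intro powr_mono') auto
      then show "z powr (\<eta> * card V) \<le> (\<Prod>v\<in>V. wt (\<psi> v))"
        using z by (simp add: prod_wt powr_realpow)
    qed
    also have "\<dots> \<le> (\<Sum>\<psi>\<in>?All. \<Prod>v\<in>V. wt (\<psi> v))"
      using fin z by (intro sum_mono2) (auto simp: wt_def intro!: prod_nonneg)
    also have "\<dots> = (\<Prod>v\<in>V. \<Sum>l\<in>insert None (Some ` L). wt l)"
      by (rule prod_sum_PiE[symmetric]) (use V L in auto)
    also have "(\<Sum>l\<in>insert None (Some ` L). wt l) = 1 + card L * z"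
    proof -
      have "(\<Sum>l\<in>Some ` L. wt l) = (\<Sum>l\<in>L. z)" by (subst sum.reindex) (auto simp: wt_def)
      moreover have "None \<notin> Some ` L" by auto
      ultimately show ?thesis using L by (simp add: wt_def)
    qed
    also have "(\<Prod>v\<in>V. 1 + card L * z) \<le> (\<Prod>v\<in>V. exp (card L * z))"
      using z by (intro prod_mono) (auto intro: add_nonneg_nonneg)
    also have "\<dots> = exp (card L * z * card V)" by (simp add: exp_of_nat_mult mult.commute)
    also have "\<dots> \<le> exp (\<tau> / 2 * card V)" using mult_right_mono[OF Lz, of "real (card V)"] by simp
    finally have 1: "card ?Sp * z powr (\<eta> * card V) \<le> exp (\<tau> / 2 * card V)" .
    have "card ?Sp = card ?Sp * z powr (\<eta> * card V) * (1 / z) powr (\<eta> * card V)"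
      using z by (simp add: powr_divide)
    also have "\<dots> \<le> exp (\<tau> / 2 * card V) * (1 / z) powr (\<eta> * card V)"
      using 1 by (intro mult_right_mono) auto
    also have "(1 / z) powr (\<eta> * card V) = exp ((\<eta> * ln (1 / z)) * card V)"
      using z by (simp add: powr_def mult_ac)
    also have "\<dots> \<le> exp (\<tau> / 2 * card V)" using mult_right_mono[OF \<eta>z, of "real (card V)"] by simp
    also have "exp (\<tau> / 2 * card V) * exp (\<tau> / 2 * card V) = exp (\<tau> * card V)"
      by (simp flip: exp_add)
    finally show ?thesis by (simp add: mult_left_mono)
  qed
  then show ?thesis using \<eta> by (intro exI[of _ \<eta>]) auto
qed

section \<open>The lower bound\<close>

locale toeplitz_entropy = toeplitz_array +
  fixes d :: "('a \<Rightarrow> nat) \<Rightarrow> ('a \<Rightarrow> nat) \<Rightarrow> real"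
  assumes dyn_gen: "dyn_gen_pseudometric G (orbit_closure G k x) (shift G) d"

sublocale toeplitz_entropy \<subseteq> subshift G k orbit_cl d
proof unfold_locales
  show "closedin (full_shift G k) orbit_cl" by (rule closed_orbit_cl)
  show "shift G s y \<in> orbit_cl" if "s \<in> carrier G" "y \<in> orbit_cl" for s y
    using that by (rule shift_orbit_cl)
  show "dyn_gen_pseudometric G (subtopology (full_shift G k) orbit_cl) (shift G) d"
    by (rule dyn_gen[unfolded orbit_closure_eq])
qed

context toeplitz_entropy
begin

lemma orbit_closure_X: "orbit_closure G k x = X"
  by (simp add: X_def orbit_closure_eq)

abbreviation act :: "nat \<Rightarrow> 'a \<Rightarrow> 'a set \<Rightarrow> 'a set" where
  "act n \<equiv> coset_action G (H n)"

lemma act_in_V: "s \<in> carrier G \<Longrightarrow> v \<in> V n \<Longrightarrow> act n s v \<in> V n"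
  using coset_action_cls cls_in_V by (auto elim!: coset_cases)

abbreviation Maps :: "'a set \<Rightarrow> real \<Rightarrow> nat \<Rightarrow> ('a set \<Rightarrow> 'a \<Rightarrow> nat) set" where
  "Maps S \<delta> n \<equiv> Map_sofic X (shift G) d S \<delta> (V n) (act n)"

lemma dist_2_le:
  assumes "finite U" "\<And>v. v \<in> U \<Longrightarrow> 0 \<le> d (\<phi> v) (\<psi> v) \<and> d (\<phi> v) (\<psi> v) \<le> \<delta>" "\<delta> \<ge> 0"
  shows "dist_2 U d \<phi> \<psi> \<le> \<delta>"
proof -
  have "(\<Sum>v\<in>U. (d (\<phi> v) (\<psi> v))\<^sup>2) \<le> (\<Sum>v\<in>U. \<delta>\<^sup>2)"
    using assms by (intro sum_mono power_mono) auto
  then have "(\<Sum>v\<in>U. (d (\<phi> v) (\<psi> v))\<^sup>2) \<le> card U * \<delta>\<^sup>2" by simp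
  then have "(\<Sum>v\<in>U. (d (\<phi> v) (\<psi> v))\<^sup>2) / card U \<le> \<delta>\<^sup>2"
    by (cases "card U = 0") (auto simp: divide_le_eq mult.commute)
  then have "dist_2 U d \<phi> \<psi> \<le> sqrt (\<delta>\<^sup>2)" unfolding dist_2_def by (rule real_sqrt_le_mono)
  then show ?thesis using assms by simp
qed

text \<open>For a filling \<open>\<omega>\<close> of the holes, \<open>p \<omega>\<close> is the periodic configuration that it defines, and the
  microstate \<open>\<phi> \<omega>\<close> assigns to a coset \<open>c H\<close> a point of the orbit of \<open>x\<close> that agrees on \<open>F j\<close> with \<open>p \<omega>\<close>
  translated by the inverse of \<open>c\<close>. Two fillings that differ in a hole \<open>C\<close> give points that differ
  at \<open>\<one>\<close>, hence are separated by more than \<open>e\<close> after some translation \<open>s\<close>; by equivariance up to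
  \<open>e/4\<close> the microstates are then separated by more than \<open>e/2\<close> at the translate of \<open>C\<close> by \<open>s\<close>.\<close>

lemma ex_many_microstates:
  "\<exists>\<epsilon>>0. \<forall>S. finite S \<longrightarrow> S \<subseteq> carrier G \<longrightarrow> (\<forall>\<delta>>0. \<exists>j0. \<forall>j\<ge>j0.
     enat (k ^ card (holes (r j) (A j))) \<le> sep_number \<epsilon> (Maps S \<delta> (r j)) (dist_inf (V (r j)) d))"
proof -
  obtain e S0 where e: "e > 0" "finite S0" "S0 \<subseteq> carrier G"
    "\<And>u v. u \<in> orbit_cl \<Longrightarrow> v \<in> orbit_cl \<Longrightarrow> u \<one> \<noteq> v \<one> \<Longrightarrow> \<exists>s\<in>S0. d (shift G s u) (shift G s v) > e"
    using origin_separation by auto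
  have main: "enat (k ^ card (holes (r j) (A j))) \<le> sep_number (e/2) (Maps S \<delta> (r j)) (dist_inf (V (r j)) d)"
    if S: "finite S" "S \<subseteq> carrier G" and \<delta>: "\<delta> > 0"
      and W: "W \<subseteq> carrier G"
        "\<And>u v. u \<in> orbit_cl \<Longrightarrow> v \<in> orbit_cl \<Longrightarrow> (\<forall>w\<in>W. u w = v w) \<Longrightarrow> d u v < min \<delta> (e/4)"
      and WF: "insert \<one> (W \<union> (\<lambda>(s, w). inv s \<otimes> w) ` ((S \<union> S0) \<times> W)) \<subseteq> F j"
    for S \<delta> W j
  proof -
    let ?n = "r j"
    let ?\<Omega> = "holes ?n (A j) \<rightarrow>\<^sub>E {1..k}"
    define p where "p = (\<lambda>\<omega> u. if u \<in> A j then x u else \<omega> (cls ?n u) :: nat)"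
    note sat = saturated_A[of j]
    have p_in: "p \<omega> \<in> carrier G \<rightarrow> {1..k}" if "\<omega> \<in> ?\<Omega>" for \<omega>
      using that x_in cls_in_holes[OF sat] unfolding p_def by fastforce
    have p_cls: "p \<omega> u = p \<omega> v" if "u \<in> carrier G" "v \<in> carrier G" "cls ?n u = cls ?n v" for \<omega> u v
      using that saturatedD[OF sat that] coset_constantD[OF coset_constant_x, of u j v]
      unfolding p_def by auto
    define g where "g = (\<lambda>\<omega> C. SOME g. g \<in> carrier G \<and> (\<forall>f\<in>F j. x (g \<otimes> f) = p \<omega> (rep C \<otimes> f)))"
    have g: "g \<omega> C \<in> carrier G" "\<And>f. f \<in> F j \<Longrightarrow> x (g \<omega> C \<otimes> f) = p \<omega> (rep C \<otimes> f)"
      if "\<omega> \<in> ?\<Omega>" "C \<in> V ?n" for \<omega> C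
    proof -
      have "\<exists>g. g \<in> carrier G \<and> (\<forall>f\<in>F j. x (g \<otimes> f) = p \<omega> (rep C \<otimes> f))"
        using patterns[OF rep_in(2)[OF that(2)] p_in[OF that(1)], of j] by (auto simp: p_def)
      from someI_ex[OF this] show "g \<omega> C \<in> carrier G"
        "\<And>f. f \<in> F j \<Longrightarrow> x (g \<omega> C \<otimes> f) = p \<omega> (rep C \<otimes> f)"
        unfolding g_def by auto
    qed
    define \<phi> where "\<phi> = (\<lambda>\<omega>. \<lambda>C\<in>V ?n. shift G (inv (g \<omega> C)) x)"
    have \<phi>_in: "\<phi> \<omega> C \<in> orbit_cl" if "\<omega> \<in> ?\<Omega>" "C \<in> V ?n" for \<omega> C
      using that g(1)[OF that] orbit_subset unfolding \<phi>_def by auto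
    have FG: "f \<in> carrier G" if "f \<in> F j" for f
      using that F_A[of j] sat unfolding saturated_def by auto
    have \<phi>_val: "\<phi> \<omega> (cls ?n c) f = p \<omega> (c \<otimes> f)" if "\<omega> \<in> ?\<Omega>" "c \<in> carrier G" "f \<in> F j" for \<omega> c f
    proof -
      let ?C = "cls ?n c"
      have C: "?C \<in> V ?n" using cls_in_V that by auto
      have "\<phi> \<omega> ?C f = x (g \<omega> ?C \<otimes> f)"
        using C shift_apply[OF FG[OF that(3)]] g(1)[OF that(1) C] unfolding \<phi>_def by simp
      also have "\<dots> = p \<omega> (rep ?C \<otimes> f)" using g(2)[OF that(1) C that(3)] .
      also have "\<dots> = p \<omega> (c \<otimes> f)"
        using rep_in[OF C] that FG cls_cancel_right by (intro p_cls) auto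
      finally show ?thesis .
    qed
    have equi: "d (\<phi> \<omega> (act ?n s v)) (shift G s (\<phi> \<omega> v)) < min \<delta> (e/4)"
      if \<omega>: "\<omega> \<in> ?\<Omega>" and s: "s \<in> S \<union> S0" and v: "v \<in> V ?n" for \<omega> s v
    proof -
      obtain c where c: "c \<in> carrier G" "v = cls ?n c" using v coset_cases by blast
      have sG: "s \<in> carrier G" using s S e by auto
      have sv: "act ?n s v = cls ?n (c \<otimes> inv s)" using coset_action_cls c sG by simp
      show ?thesis
      proof (rule W(2))
        show "\<phi> \<omega> (act ?n s v) \<in> orbit_cl" unfolding sv
          by (rule \<phi>_in[OF \<omega>]) (use cls_in_V c sG in auto)
        show "shift G s (\<phi> \<omega> v) \<in> orbit_cl" using shift_orbit_cl[OF sG \<phi>_in[OF \<omega> v]] .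
        show "\<forall>w\<in>W. \<phi> \<omega> (act ?n s v) w = shift G s (\<phi> \<omega> v) w"
        proof
          fix w assume w: "w \<in> W"
          have wF: "w \<in> F j" "inv s \<otimes> w \<in> F j" using WF w s by (auto simp: image_subset_iff)
          have "\<phi> \<omega> (act ?n s v) w = p \<omega> (c \<otimes> inv s \<otimes> w)"
            unfolding sv using \<phi>_val[OF \<omega> _ wF(1)] c sG by simp
          also have "\<dots> = p \<omega> (c \<otimes> (inv s \<otimes> w))" using c sG FG[OF wF(1)] by (simp add: m_assoc)
          also have "\<dots> = \<phi> \<omega> v (inv s \<otimes> w)" using \<phi>_val[OF \<omega> c(1) wF(2)] c by simp
          finally show "\<phi> \<omega> (act ?n s v) w = shift G s (\<phi> \<omega> v) w"
            using shift_apply[OF FG[OF wF(1)]] by simp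
        qed
      qed
    qed
    have sep: "dist_inf (V ?n) d (\<phi> \<omega>) (\<phi> \<omega>') > e/2"
      if \<omega>: "\<omega> \<in> ?\<Omega>" "\<omega>' \<in> ?\<Omega>" "\<omega> \<noteq> \<omega>'" for \<omega> \<omega>'
    proof -
      obtain C where C: "C \<in> holes ?n (A j)" "\<omega> C \<noteq> \<omega>' C"
        using PiE_ext[OF \<omega>(1,2)] \<omega>(3) by blast
      have CV: "C \<in> V ?n" and "rep C \<notin> A j" using C rep_in[of C ?n] unfolding holes_def by auto
      then have "\<phi> \<omega> C \<one> = \<omega> C" if "\<omega> \<in> ?\<Omega>" for \<omega>
        using \<phi>_val[OF that, of "rep C" \<one>] rep_in[OF CV] WF unfolding p_def by simp
      then have "\<phi> \<omega> C \<one> \<noteq> \<phi> \<omega>' C \<one>" using C \<omega> by simp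
      then obtain s where s: "s \<in> S0" "d (shift G s (\<phi> \<omega> C)) (shift G s (\<phi> \<omega>' C)) > e"
        using e(4)[OF \<phi>_in[OF \<omega>(1) CV] \<phi>_in[OF \<omega>(2) CV]] by blast
      have sG: "s \<in> carrier G" using s e by auto
      let ?v = "act ?n s C"
      have v: "?v \<in> V ?n" using act_in_V sG CV by simp
      note in1 = \<phi>_in[OF \<omega>(1) v] \<phi>_in[OF \<omega>(2) v] shift_orbit_cl[OF sG \<phi>_in[OF \<omega>(1) CV]]
        shift_orbit_cl[OF sG \<phi>_in[OF \<omega>(2) CV]]
      have "d (\<phi> \<omega> ?v) (shift G s (\<phi> \<omega> C)) < e/4" "d (\<phi> \<omega>' ?v) (shift G s (\<phi> \<omega>' C)) < e/4"
        using equi[OF \<omega>(1) _ CV, of s] equi[OF \<omega>(2) _ CV, of s] s by auto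
      moreover have "d (shift G s (\<phi> \<omega> C)) (shift G s (\<phi> \<omega>' C)) \<le>
        d (shift G s (\<phi> \<omega> C)) (\<phi> \<omega> ?v) + d (\<phi> \<omega> ?v) (shift G s (\<phi> \<omega>' C))"
        using d_triangle in1 by blast
      moreover have "d (\<phi> \<omega> ?v) (shift G s (\<phi> \<omega>' C)) \<le>
        d (\<phi> \<omega> ?v) (\<phi> \<omega>' ?v) + d (\<phi> \<omega>' ?v) (shift G s (\<phi> \<omega>' C))"
        using d_triangle in1 by blast
      moreover have "d (shift G s (\<phi> \<omega> C)) (\<phi> \<omega> ?v) = d (\<phi> \<omega> ?v) (shift G s (\<phi> \<omega> C))"
        using d_sym in1 by blast
      ultimately have "d (\<phi> \<omega> ?v) (\<phi> \<omega>' ?v) > e/2" using s(2) by linarith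
      also have "d (\<phi> \<omega> ?v) (\<phi> \<omega>' ?v) \<le> dist_inf (V ?n) d (\<phi> \<omega>) (\<phi> \<omega>')"
        unfolding dist_inf_def using finite_V v by (intro Max_ge) auto
      finally show ?thesis .
    qed
    have d_same: "dist_inf (V ?n) d (\<phi> \<omega>) (\<phi> \<omega>) = 0" if "\<omega> \<in> ?\<Omega>" for \<omega>
    proof -
      have "(\<lambda>v. d (\<phi> \<omega> v) (\<phi> \<omega> v)) ` V ?n = {0}"
        using d_refl \<phi>_in[OF that] V_nonempty[of ?n] by force
      then show ?thesis unfolding dist_inf_def by simp
    qed
    have inj: "inj_on \<phi> ?\<Omega>"
    proof (rule inj_onI)
      fix \<omega> \<omega>' assume \<omega>: "\<omega> \<in> ?\<Omega>" "\<omega>' \<in> ?\<Omega>" "\<phi> \<omega> = \<phi> \<omega>'"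
      then show "\<omega> = \<omega>'" using sep[of \<omega> \<omega>'] d_same[of \<omega>] e(1) by fastforce
    qed
    have "\<phi> ` ?\<Omega> \<subseteq> Maps S \<delta> ?n"
    proof (rule image_subsetI)
      fix \<omega> assume \<omega>: "\<omega> \<in> ?\<Omega>"
      have "dist_2 (V ?n) d (\<lambda>v. \<phi> \<omega> (act ?n s v)) (\<lambda>v. shift G s (\<phi> \<omega> v)) \<le> \<delta>" if s: "s \<in> S" for s
      proof (rule dist_2_le)
        fix v assume v: "v \<in> V ?n"
        have sG: "s \<in> carrier G" using s S by auto
        show "0 \<le> d (\<phi> \<omega> (act ?n s v)) (shift G s (\<phi> \<omega> v)) \<and>
          d (\<phi> \<omega> (act ?n s v)) (shift G s (\<phi> \<omega> v)) \<le> \<delta>"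
          using equi[OF \<omega> _ v, of s] s
            d_nonneg[OF \<phi>_in[OF \<omega> act_in_V[OF sG v]] shift_orbit_cl[OF sG \<phi>_in[OF \<omega> v]]] by auto
      qed (use finite_V \<delta> in auto)
      moreover have "\<phi> \<omega> \<in> V ?n \<rightarrow>\<^sub>E topspace X"
        unfolding topspace_X using \<phi>_in[OF \<omega>] by (auto simp: \<phi>_def)
      ultimately show "\<phi> \<omega> \<in> Maps S \<delta> ?n" unfolding Map_sofic_def by simp
    qed
    moreover have "finite (\<phi> ` ?\<Omega>)" by (intro finite_imageI finite_PiE finite_holes) auto
    ultimately have "enat (card (\<phi> ` ?\<Omega>)) \<le> sep_number (e/2) (Maps S \<delta> ?n) (dist_inf (V ?n) d)"
      using sep by (intro le_sep_number) auto
    then show ?thesis using card_image[OF inj] by (simp add: card_PiE finite_holes)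
  qed
  show ?thesis
  proof (intro exI[of _ "e/2"] conjI allI impI)
    show "e/2 > 0" using e by simp
    fix S :: "'a set" and \<delta> :: real assume S: "finite S" "S \<subseteq> carrier G" and \<delta>: "\<delta> > 0"
    have "min \<delta> (e/4) > 0" using \<delta> e by simp
    from agree_imp_close[OF this] obtain W where W: "finite W" "W \<subseteq> carrier G"
        "\<forall>u\<in>orbit_cl. \<forall>v\<in>orbit_cl. (\<forall>w\<in>W. u w = v w) \<longrightarrow> d u v < min \<delta> (e/4)"
      by (elim exE conjE) (rule that)
    let ?W = "insert \<one> (W \<union> (\<lambda>(s, w). inv s \<otimes> w) ` ((S \<union> S0) \<times> W))"
    have "finite ?W" using W S e by simp
    moreover have "?W \<subseteq> carrier G"
      using subsetD[OF W(2)] subsetD[OF S(2)] subsetD[OF e(3)] by auto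
    ultimately obtain j0 where j0: "\<forall>j\<ge>j0. ?W \<subseteq> F j" using F_exhausts[of ?W] by auto
    show "\<exists>j0. \<forall>j\<ge>j0. enat (k ^ card (holes (r j) (A j))) \<le>
      sep_number (e/2) (Maps S \<delta> (r j)) (dist_inf (V (r j)) d)"
    proof (intro exI[of _ j0] allI impI)
      fix j assume "j \<ge> j0"
      then have "?W \<subseteq> F j" using j0 by blast
      then show "enat (k ^ card (holes (r j) (A j))) \<le>
        sep_number (e/2) (Maps S \<delta> (r j)) (dist_inf (V (r j)) d)"
        using W(3) by (intro main[OF S \<delta> W(2)]) auto
    qed
  qed
qed

section \<open>The upper bound\<close>

lemma act_act:
  assumes "s \<in> carrier G" "t \<in> carrier G" "v \<in> V n"
  shows "act n s (act n t v) = act n (s \<otimes> t) v"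
  using assms by (auto elim!: coset_cases simp: coset_action_cls inv_mult_group m_assoc)

lemma act_one: "v \<in> V n \<Longrightarrow> act n \<one> v = v"
  by (auto elim!: coset_cases simp: coset_action_cls)

lemma Maps_in: "\<phi> \<in> Maps S \<delta> n \<Longrightarrow> v \<in> V n \<Longrightarrow> \<phi> v \<in> orbit_cl"
  unfolding Map_sofic_def topspace_X by auto

lemma orbit_cl_value: "y \<in> orbit_cl \<Longrightarrow> u \<in> carrier G \<Longrightarrow> y u \<in> {1..k}"
  by (rule PiE_mem[OF subsetD[OF Y_subset]])

text \<open>The pattern of \<open>x\<close> on a translate \<open>g T\<close> of the transversal \<open>T\<close> is known at the filled cells
  as soon as the coset of \<open>g\<close> is known, and exactly one cell of \<open>g T\<close> lies in each hole.\<close>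

lemma card_language:
  "card ((\<lambda>y. restrict y (rep ` V (r j))) ` orbit_cl) \<le> card (V (r j)) * k ^ card (holes (r j) (A j))"
proof -
  let ?n = "r j"
  let ?T = "rep ` V ?n"
  note sat = saturated_A[of j]
  have TG: "t \<in> carrier G" if "t \<in> ?T" for t using that rep_in by auto
  have finT: "finite ?T" using finite_V by simp
  define Pat where "Pat = (\<lambda>C. \<Pi>\<^sub>E t\<in>?T. if rep C \<otimes> t \<in> A j then {x (rep C \<otimes> t)} else {1..k})"
  have cardPat: "card (Pat C) \<le> k ^ card (holes ?n (A j))" if C: "C \<in> V ?n" for C
  proof -
    let ?B = "{t \<in> ?T. rep C \<otimes> t \<notin> A j}"
    have c: "rep C \<in> carrier G" using rep_in C by auto
    have inj: "inj_on (\<lambda>t. cls ?n (rep C \<otimes> t)) ?B"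
    proof (rule inj_onI)
      fix t t' assume t: "t \<in> ?B" "t' \<in> ?B" "cls ?n (rep C \<otimes> t) = cls ?n (rep C \<otimes> t')"
      then have "cls ?n t = cls ?n t'" using cls_cancel_left c TG by auto
      then show "t = t'" using t rep_in by auto
    qed
    have "card ?B \<le> card (holes ?n (A j))"
      by (rule card_inj_on_le[OF inj _ finite_holes]) (use cls_in_holes[OF sat] c TG in auto)
    then have B: "k ^ card ?B \<le> k ^ card (holes ?n (A j))" using k by (intro power_increasing) auto
    have "card (Pat C) = (\<Prod>t\<in>?T. if rep C \<otimes> t \<notin> A j then k else 1)"
      unfolding Pat_def using finT by (subst card_PiE) (auto intro!: prod.cong)
    also have "\<dots> = (\<Prod>t\<in>?B. k)" using finT by (rule prod.inter_filter[symmetric])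
    also have "\<dots> = k ^ card ?B" by simp
    finally show ?thesis using B by simp
  qed
  have "(\<lambda>y. restrict y ?T) ` orbit_cl \<subseteq> (\<Union>C\<in>V ?n. Pat C)"
  proof (rule image_subsetI)
    fix y assume y: "y \<in> orbit_cl"
    obtain g where g: "g \<in> carrier G" "\<forall>t\<in>?T. y t = x (g \<otimes> t)"
      using orbit_cl_pattern[OF y finT] TG by blast
    let ?C = "cls ?n g"
    have C: "?C \<in> V ?n" using cls_in_V g by auto
    have "restrict y ?T \<in> Pat ?C"
      unfolding Pat_def
    proof (rule restrict_PiE_iff[THEN iffD2], rule ballI)
      fix t assume t: "t \<in> ?T"
      have "cls ?n (rep ?C \<otimes> t) = cls ?n (g \<otimes> t)"
        using cls_cancel_right rep_in[OF C] g TG[OF t] by auto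
      then have "x (rep ?C \<otimes> t) = x (g \<otimes> t)" if "rep ?C \<otimes> t \<in> A j"
        using coset_constantD[OF coset_constant_x that] rep_in[OF C] g TG[OF t] by simp
      then show "y t \<in> (if rep ?C \<otimes> t \<in> A j then {x (rep ?C \<otimes> t)} else {1..k})"
        using g(2) t orbit_cl_value[OF y TG[OF t]] by auto
    qed
    then show "restrict y ?T \<in> (\<Union>C\<in>V ?n. Pat C)" using C by blast
  qed
  moreover have "finite (\<Union>C\<in>V ?n. Pat C)"
    using finite_V finT unfolding Pat_def by (intro finite_UN_I finite_PiE) auto
  ultimately have "card ((\<lambda>y. restrict y ?T) ` orbit_cl) \<le> card (\<Union>C\<in>V ?n. Pat C)"
    by (rule card_mono[rotated])
  also have "\<dots> \<le> (\<Sum>C\<in>V ?n. card (Pat C))" by (rule card_UN_le[OF finite_V])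
  also have "\<dots> \<le> (\<Sum>C\<in>V ?n. k ^ card (holes ?n (A j)))" by (rule sum_mono[OF cardPat])
  finally show ?thesis by simp
qed

definition defect :: "nat \<Rightarrow> ('a set \<Rightarrow> 'a \<Rightarrow> nat) \<Rightarrow> real \<Rightarrow> 'a \<Rightarrow> 'a set set" where
  "defect n \<phi> \<theta> t = {v \<in> V n. d (\<phi> (act n t v)) (shift G t (\<phi> v)) > \<theta>}"

text \<open>The points whose translate by some \<open>s \<in> T\<close> has a defect. Translates have to be included because
  comparing letters at \<open>s v\<close> uses equivariance at \<open>s v\<close> and not only at \<open>v\<close>.\<close>

definition bad :: "nat \<Rightarrow> ('a set \<Rightarrow> 'a \<Rightarrow> nat) \<Rightarrow> real \<Rightarrow> 'a set \<Rightarrow> 'a set \<Rightarrow> 'a set set" where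
  "bad n \<phi> \<theta> T W = (\<Union>s\<in>T. act n (inv s) ` (\<Union>t\<in>W. defect n \<phi> \<theta> t))"

text \<open>Chebyshev's inequality for the mean square distance.\<close>

lemma card_defect:
  assumes \<phi>: "\<phi> \<in> Maps S \<delta> n" and t: "t \<in> S" and \<theta>: "\<theta> > 0"
  shows "card (defect n \<phi> \<theta> t) \<le> (\<delta> / \<theta>)\<^sup>2 * card (V n)"
proof -
  let ?q = "\<lambda>v. (d (\<phi> (act n t v)) (shift G t (\<phi> v)))\<^sup>2"
  have "dist_2 (V n) d (\<lambda>v. \<phi> (act n t v)) (\<lambda>v. shift G t (\<phi> v)) \<le> \<delta>"
    using \<phi> t unfolding Map_sofic_def by blast
  then have "(\<Sum>v\<in>V n. ?q v) / card (V n) \<le> \<delta>\<^sup>2" unfolding dist_2_def by (rule sqrt_le_D)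
  then have 1: "(\<Sum>v\<in>V n. ?q v) \<le> \<delta>\<^sup>2 * card (V n)"
    using card_V_pos[of n] by (simp add: divide_le_eq)
  have "card (defect n \<phi> \<theta> t) * \<theta>\<^sup>2 = (\<Sum>v\<in>defect n \<phi> \<theta> t. \<theta>\<^sup>2)" by simp
  also have "\<dots> \<le> (\<Sum>v\<in>defect n \<phi> \<theta> t. ?q v)"
    using \<theta> by (intro sum_mono power_mono) (auto simp: defect_def)
  also have "\<dots> \<le> (\<Sum>v\<in>V n. ?q v)"
    by (intro sum_mono2 finite_V) (auto simp: defect_def)
  finally have "card (defect n \<phi> \<theta> t) * \<theta>\<^sup>2 \<le> \<delta>\<^sup>2 * card (V n)" using 1 by linarith
  then show ?thesis using \<theta> by (simp add: power_divide field_simps)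
qed

lemma card_bad:
  assumes \<phi>: "\<phi> \<in> Maps W \<delta> n" and \<theta>: "\<theta> > 0" and T: "finite T" and W: "finite W"
  shows "card (bad n \<phi> \<theta> T W) \<le> card T * card W * (\<delta> / \<theta>)\<^sup>2 * card (V n)"
proof -
  let ?D = "\<Union>t\<in>W. defect n \<phi> \<theta> t"
  have finD: "finite ?D" using W finite_V by (auto simp: defect_def)
  have "card ?D \<le> (\<Sum>t\<in>W. card (defect n \<phi> \<theta> t))" by (rule card_UN_le[OF W])
  then have "real (card ?D) \<le> (\<Sum>t\<in>W. real (card (defect n \<phi> \<theta> t)))"
    by (metis of_nat_le_iff of_nat_sum)
  also have "\<dots> \<le> (\<Sum>t\<in>W. (\<delta> / \<theta>)\<^sup>2 * card (V n))"
    by (intro sum_mono card_defect[OF \<phi> _ \<theta>])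
  finally have D: "real (card ?D) \<le> card W * (\<delta> / \<theta>)\<^sup>2 * card (V n)" by simp
  have "card (bad n \<phi> \<theta> T W) \<le> (\<Sum>s\<in>T. card (act n (inv s) ` ?D))"
    unfolding bad_def by (rule card_UN_le[OF T])
  also have "\<dots> \<le> (\<Sum>s\<in>T. card ?D)" by (intro sum_mono card_image_le finD)
  finally have "card (bad n \<phi> \<theta> T W) \<le> card T * card ?D" by simp
  then have "real (card (bad n \<phi> \<theta> T W)) \<le> card T * real (card ?D)"
    by (metis of_nat_le_iff of_nat_mult)
  also have "\<dots> \<le> card T * (card W * (\<delta> / \<theta>)\<^sup>2 * card (V n))"
    by (intro mult_left_mono D) auto
  finally show ?thesis by (simp add: mult_ac)
qed

lemma not_bad:
  assumes "s \<in> T" "T \<subseteq> carrier G" "t \<in> W" "v \<in> V n" "v \<notin> bad n \<phi> \<theta> T W"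
  shows "d (\<phi> (act n t (act n s v))) (shift G t (\<phi> (act n s v))) \<le> \<theta>"
proof (rule ccontr)
  assume "\<not> ?thesis"
  moreover have s: "s \<in> carrier G" using assms by auto
  ultimately have "act n s v \<in> defect n \<phi> \<theta> t"
    using act_in_V assms(4) unfolding defect_def by auto
  moreover have "v = act n (inv s) (act n s v)"
    using s assms(4) by (simp add: act_act act_one)
  ultimately have "v \<in> bad n \<phi> \<theta> T W" unfolding bad_def using assms by blast
  then show False using assms by simp
qed

text \<open>Were the letters different, some \<open>t \<in> S\<close> would separate \<open>\<phi> (s v)\<close> from \<open>s (\<phi> v)\<close> by more than
  \<open>e\<close>. But at a point that is not bad, both \<open>t (\<phi> (s v))\<close> and \<open>(t s) (\<phi> v)\<close> are within \<open>e/2\<close> of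
  \<open>\<phi> ((t s) v)\<close>.\<close>

lemma good_point_value:
  assumes e: "e > 0" "S \<subseteq> carrier G"
      "\<And>u v. u \<in> orbit_cl \<Longrightarrow> v \<in> orbit_cl \<Longrightarrow> u \<one> \<noteq> v \<one> \<Longrightarrow> \<exists>s\<in>S. d (shift G s u) (shift G s v) > e"
    and T: "\<one> \<in> T" "T \<subseteq> carrier G" and s: "s \<in> T"
    and W: "S \<subseteq> W" "\<And>t. t \<in> S \<Longrightarrow> t \<otimes> s \<in> W"
    and \<phi>: "\<And>v. v \<in> V n \<Longrightarrow> \<phi> v \<in> orbit_cl"
    and v: "v \<in> V n" "v \<notin> bad n \<phi> (e/2) T W"
  shows "\<phi> (act n s v) \<one> = \<phi> v (inv s)"
proof (rule ccontr)
  assume neq: "\<phi> (act n s v) \<one> \<noteq> \<phi> v (inv s)"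
  have sG: "s \<in> carrier G" using s T by auto
  have sv: "act n s v \<in> V n" using act_in_V sG v by simp
  let ?u = "\<phi> (act n s v)" and ?u' = "shift G s (\<phi> v)"
  have uu: "?u \<in> orbit_cl" "?u' \<in> orbit_cl" using \<phi> sv v(1) shift_orbit_cl[OF sG] by auto
  have "?u' \<one> = \<phi> v (inv s)" using sG by (simp add: shift_apply)
  then have "?u \<one> \<noteq> ?u' \<one>" using neq by simp
  then obtain t where t: "t \<in> S" "d (shift G t ?u) (shift G t ?u') > e"
    using e(3) uu by blast
  have tG: "t \<in> carrier G" using t e by auto
  let ?a = "\<phi> (act n t (act n s v))"
  have aa: "?a \<in> orbit_cl" "shift G t ?u \<in> orbit_cl" "shift G t ?u' \<in> orbit_cl"
    using \<phi> act_in_V tG sv shift_orbit_cl[OF tG] uu by auto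
  have "d ?a (shift G t ?u) \<le> e/2"
    using not_bad[OF s T(2) _ v] t W by blast
  moreover have "d ?a (shift G t ?u') \<le> e/2"
  proof -
    have "d (\<phi> (act n (t \<otimes> s) (act n \<one> v))) (shift G (t \<otimes> s) (\<phi> (act n \<one> v))) \<le> e/2"
      using not_bad[OF T W(2)[OF t(1)] v] .
    then show ?thesis using act_act[OF tG sG v(1)] act_one v(1) shift_shift[OF tG sG] by simp
  qed
  moreover have "d (shift G t ?u) (shift G t ?u') \<le> d (shift G t ?u) ?a + d ?a (shift G t ?u')"
    using d_triangle aa by blast
  moreover have "d (shift G t ?u) ?a = d ?a (shift G t ?u)" using d_sym aa by blast
  ultimately show False using t(2) by linarith
qed

text \<open>The tiles centred at \<open>subcosets m n\<close> cover \<open>V n\<close>.\<close>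

lemma coset_from_centre:
  assumes "m \<le> n" "u \<in> V n"
  obtains c t where "c \<in> subcosets m n" "t \<in> rep ` V m" "u = act n (inv t) c"
proof -
  obtain g where g: "g \<in> carrier G" "u = cls n g" using assms(2) coset_cases by blast
  let ?t = "rep (cls m g)"
  have t: "?t \<in> carrier G" "cls m ?t = cls m g" using rep_in[OF cls_in_V[OF g(1)]] by auto
  let ?e = "g \<otimes> inv ?t"
  have e: "?e \<in> carrier G" using g t by auto
  have "cls m ?e = cls m (?t \<otimes> inv ?t)"
    by (subst cls_cancel_right) (use g t in auto)
  then have "?e \<in> H m" using cls_one_iff[OF e] t by simp
  then have "cls n ?e \<in> subcosets m n" unfolding subcosets_def by auto
  moreover have "u = act n (inv ?t) (cls n ?e)"
    using g t e by (simp add: coset_action_cls m_assoc)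
  moreover have "?t \<in> rep ` V m" using cls_in_V[OF g(1)] by auto
  ultimately show ?thesis using that by blast
qed

lemma subcosets_V: "subcosets m n \<subseteq> V n"
  unfolding subcosets_def using H_carrier cls_in_V by auto

text \<open>The letters of a microstate on a tile are read off from its value at the centre of the tile, if
  the centre is not bad; the other tiles are covered by the assumptions on \<open>B\<close>. Once all letters
  coincide, so do the values on \<open>W0\<close> at every point outside \<open>B\<close>.\<close>

lemma microstates_determined:
  fixes m n :: nat
  defines "T' \<equiv> rep ` V m"
  assumes mn: "m \<le> n"
    and W0: "W0 \<subseteq> carrier G"
      "\<And>u v. u \<in> orbit_cl \<Longrightarrow> v \<in> orbit_cl \<Longrightarrow> (\<forall>w\<in>W0. u w = v w) \<Longrightarrow> d u v < \<epsilon>"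
    and in_cl: "\<And>v. v \<in> V n \<Longrightarrow> \<phi> v \<in> orbit_cl" "\<And>v. v \<in> V n \<Longrightarrow> \<phi>' v \<in> orbit_cl"
    and good: "\<And>v w. v \<in> V n \<Longrightarrow> v \<notin> B \<Longrightarrow> w \<in> W0 \<union> T' \<Longrightarrow> \<phi> (act n (inv w) v) \<one> = \<phi> v w"
      "\<And>v w. v \<in> V n \<Longrightarrow> v \<notin> B \<Longrightarrow> w \<in> W0 \<union> T' \<Longrightarrow> \<phi>' (act n (inv w) v) \<one> = \<phi>' v w"
    and centre: "\<And>c t. c \<in> subcosets m n \<Longrightarrow> t \<in> T' \<Longrightarrow> \<phi> c t = \<phi>' c t"
    and bad: "\<And>v w. v \<in> V n \<Longrightarrow> v \<in> B \<Longrightarrow> w \<in> W0 \<Longrightarrow> \<phi> v w = \<phi>' v w"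
      "\<And>v t. v \<in> V n \<Longrightarrow> v \<in> B \<Longrightarrow> t \<in> T' \<Longrightarrow> \<phi> (act n (inv t) v) \<one> = \<phi>' (act n (inv t) v) \<one>"
    and v: "v \<in> V n"
  shows "d (\<phi> v) (\<phi>' v) < \<epsilon>"
proof (rule W0(2))
  show "\<phi> v \<in> orbit_cl" "\<phi>' v \<in> orbit_cl" using in_cl v by auto
  have same: "\<phi> u \<one> = \<phi>' u \<one>" if u: "u \<in> V n" for u
  proof -
    obtain c t where ct: "c \<in> subcosets m n" "t \<in> T'" "u = act n (inv t) c"
      using coset_from_centre[OF mn u] unfolding T'_def by blast
    have c: "c \<in> V n" using ct subcosets_V by auto
    show ?thesis
    proof (cases "c \<in> B")
      case True
      then show ?thesis using bad(2)[OF c _ ct(2)] ct(3) by simp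
    next
      case False
      then show ?thesis using good[OF c, of t] centre[OF ct(1,2)] ct by simp
    qed
  qed
  show "\<forall>w\<in>W0. \<phi> v w = \<phi>' v w"
  proof
    fix w assume w: "w \<in> W0"
    have "act n (inv w) v \<in> V n" using w W0(1) v act_in_V by auto
    then show "\<phi> v w = \<phi>' v w"
      using same[of "act n (inv w) v"] good[OF v, of w] bad(1)[OF v _ w] w by (cases "v \<in> B") auto
  qed
qed


text \<open>The bound of the exponential growth rate obtained from the tiles of stage \<open>j\<close>.\<close>

definition rate :: "nat \<Rightarrow> real" where
  "rate j = (ln (card (V (r j))) + card (holes (r j) (A j)) * ln k) / card (V (r j))"

text \<open>A microstate \<open>\<phi>\<close> is encoded by \<open>tile \<phi>\<close>, its patterns at the centres of the tiles, and the sparse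
  labelling \<open>lab \<phi>\<close>, which records at each bad point the value on \<open>W0\<close> and the letters of the tile
  centred there. Microstates with the same code are closer than \<open>\<epsilon>\<close> by \<open>microstates_determined\<close>, so
  a separated set is at most as large as the set of codes.\<close>

lemma few_microstates:
  assumes \<epsilon>: "\<epsilon> > 0" and \<tau>: "\<tau> > 0"
  shows "\<exists>S \<delta>. finite S \<and> S \<subseteq> carrier G \<and> \<delta> > 0 \<and> (\<forall>n\<ge>r j.
    log_enat (sep_number \<epsilon> (Maps S \<delta> n) (dist_inf (V n) d)) \<le> ereal ((\<tau> + rate j) * card (V n)))"
proof -
  obtain e S0 where e: "e > 0" "finite S0" "S0 \<subseteq> carrier G"
    "\<And>u v. u \<in> orbit_cl \<Longrightarrow> v \<in> orbit_cl \<Longrightarrow> u \<one> \<noteq> v \<one> \<Longrightarrow> \<exists>s\<in>S0. d (shift G s u) (shift G s v) > e"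
    using origin_separation by auto
  from agree_imp_close[OF \<epsilon>] obtain W0 where W0: "finite W0" "W0 \<subseteq> carrier G"
      "\<forall>u\<in>orbit_cl. \<forall>v\<in>orbit_cl. (\<forall>w\<in>W0. u w = v w) \<longrightarrow> d u v < \<epsilon>"
    by (elim exE conjE) (rule that)
  let ?m = "r j"
  define T' where "T' = rep ` V ?m"
  have T': "finite T'" "T' \<subseteq> carrier G" unfolding T'_def using finite_V rep_in by auto
  define T where "T = insert \<one> ((\<lambda>w. inv w) ` (W0 \<union> T'))"
  have T: "finite T" "T \<subseteq> carrier G" "\<one> \<in> T"
    unfolding T_def using W0(1) T'(1) subsetD[OF W0(2)] subsetD[OF T'(2)] by auto
  have inT: "inv w \<in> T" if "w \<in> W0 \<union> T'" for w using that unfolding T_def by blast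
  define W where "W = S0 \<union> (\<lambda>(t, s). t \<otimes> s) ` (S0 \<times> T)"
  have W: "finite W" "W \<subseteq> carrier G" "S0 \<subseteq> W" "\<And>t s. t \<in> S0 \<Longrightarrow> s \<in> T \<Longrightarrow> t \<otimes> s \<in> W"
    unfolding W_def using e(2) T(1) subsetD[OF e(3)] subsetD[OF T(2)] by auto
  define L where "L = (W0 \<rightarrow>\<^sub>E {1..k}) \<times> (T' \<rightarrow>\<^sub>E {1..k})"
  have L: "finite L" unfolding L_def using W0 T' by (intro finite_cartesian_product finite_PiE) auto
  obtain \<eta> :: real where \<eta>: "\<eta> > 0" "\<And>U :: 'a set set. finite U \<Longrightarrow>
    card {\<psi> \<in> U \<rightarrow>\<^sub>E insert None (Some ` L). card {v\<in>U. \<psi> v \<noteq> None} \<le> \<eta> * card U} \<le> exp (\<tau> * card U)"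
    using sparse_labellings[OF \<tau> L] by blast
  (* the value of \<delta> for which card_bad bounds the proportion of bad points by \<eta> *)
  define q where "q = real (card T * card W)"
  define \<delta> where "\<delta> = e/2 * sqrt (\<eta> / (q + 1))"
  have q: "q \<ge> 0" by (simp add: q_def)
  have \<delta>: "\<delta> > 0" using e \<eta> q by (simp add: \<delta>_def)
  have "(\<delta> / (e/2))\<^sup>2 = \<eta> / (q + 1)" using e \<eta> q by (simp add: \<delta>_def)
  then have "q * (\<delta> / (e/2))\<^sup>2 = \<eta> * (q / (q + 1))" by simp
  also have "\<dots> \<le> \<eta> * 1" using \<eta> q by (intro mult_left_mono) auto
  finally have q\<delta>: "q * (\<delta> / (e/2))\<^sup>2 \<le> \<eta>" by simp
  let ?lang = "(\<lambda>y. restrict y T') ` orbit_cl"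
  let ?M = "card (V ?m)"
  let ?h = "card (holes ?m (A j))"
  have "log_enat (sep_number \<epsilon> (Maps W \<delta> n) (dist_inf (V n) d)) \<le> ereal ((\<tau> + rate j) * card (V n))"
    if n: "n \<ge> ?m" for n
  proof -
    let ?sub = "subcosets ?m n"
    define \<Lambda> where "\<Lambda> = {\<psi> \<in> V n \<rightarrow>\<^sub>E insert None (Some ` L). card {v\<in>V n. \<psi> v \<noteq> None} \<le> \<eta> * card (V n)}"
    define B where "B = (\<lambda>\<phi>. bad n \<phi> (e/2) T W)"
    define lab where "lab = (\<lambda>\<phi>. \<lambda>v\<in>V n. if v \<in> B \<phi>
       then Some (restrict (\<phi> v) W0, \<lambda>t\<in>T'. \<phi> (act n (inv t) v) \<one>) else None)"
    define tile where "tile = (\<lambda>\<phi> :: 'a set \<Rightarrow> 'a \<Rightarrow> nat. \<lambda>c\<in>?sub. restrict (\<phi> c) T')"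
    have finsub: "finite ?sub" using finite_subset[OF subcosets_V finite_V] .
    have fin\<Lambda>: "finite \<Lambda>"
      unfolding \<Lambda>_def by (rule finite_subset[of _ "V n \<rightarrow>\<^sub>E insert None (Some ` L)"])
        (use L finite_V in \<open>auto intro!: finite_PiE\<close>)
    have "?lang \<subseteq> T' \<rightarrow>\<^sub>E {1..k}"
      using orbit_cl_value subsetD[OF T'(2)] by (intro image_subsetI restrict_PiE_iff[THEN iffD2] ballI) auto
    then have finlang: "finite ?lang" by (rule finite_subset) (use T' in \<open>auto intro!: finite_PiE\<close>)
    have lab_in: "lab \<phi> \<in> \<Lambda>" if \<phi>: "\<phi> \<in> Maps W \<delta> n" for \<phi>
    proof -
      have "{v\<in>V n. lab \<phi> v \<noteq> None} \<subseteq> B \<phi>" unfolding lab_def by auto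
      moreover have "finite (B \<phi>)" unfolding B_def bad_def defect_def using T W finite_V by auto
      ultimately have "card {v\<in>V n. lab \<phi> v \<noteq> None} \<le> card (B \<phi>)" by (intro card_mono)
      then have "real (card {v\<in>V n. lab \<phi> v \<noteq> None}) \<le> card (B \<phi>)" by simp
      also have "\<dots> \<le> q * (\<delta> / (e/2))\<^sup>2 * card (V n)"
        unfolding B_def q_def using card_bad[OF \<phi> _ T(1) W(1), of "e/2"] e by simp
      also have "\<dots> \<le> \<eta> * card (V n)" using q\<delta> by (intro mult_right_mono) auto
      finally have "card {v\<in>V n. lab \<phi> v \<noteq> None} \<le> \<eta> * card (V n)" .
      moreover have "(restrict (\<phi> v) W0, \<lambda>t\<in>T'. \<phi> (act n (inv t) v) \<one>) \<in> L" if v: "v \<in> V n" for v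
      proof -
        have "\<phi> v w \<in> {1..k}" if "w \<in> W0" for w
          using orbit_cl_value[OF Maps_in[OF \<phi> v]] that W0(2) by blast
        moreover have "\<phi> (act n (inv t) v) \<one> \<in> {1..k}" if "t \<in> T'" for t
          using orbit_cl_value[OF Maps_in[OF \<phi> act_in_V[OF _ v]]] that T'(2) by auto
        ultimately show ?thesis unfolding L_def by auto
      qed
      ultimately show ?thesis unfolding \<Lambda>_def lab_def by auto
    qed
    have tile_in: "tile \<phi> \<in> ?sub \<rightarrow>\<^sub>E ?lang" if \<phi>: "\<phi> \<in> Maps W \<delta> n" for \<phi>
    proof -
      have "\<phi> c \<in> orbit_cl" if "c \<in> ?sub" for c using Maps_in[OF \<phi>] subsetD[OF subcosets_V that] by blast
      then show ?thesis unfolding tile_def by auto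
    qed
    have good: "\<phi> (act n (inv w) v) \<one> = \<phi> v w"
      if \<phi>: "\<phi> \<in> Maps W \<delta> n" and v: "v \<in> V n" "v \<notin> B \<phi>" and w: "w \<in> W0 \<union> T'" for \<phi> v w
    proof -
      have wG: "w \<in> carrier G" using w W0 T' by auto
      show ?thesis
        using good_point_value[OF e(1,3,4) T(3,2) inT[OF w] W(3) W(4)[OF _ inT[OF w]] Maps_in[OF \<phi>] v(1)]
          v(2) wG unfolding B_def by simp
    qed
    have close: "d (\<phi> v) (\<phi>' v) < \<epsilon>"
      if \<phi>: "\<phi> \<in> Maps W \<delta> n" and \<phi>': "\<phi>' \<in> Maps W \<delta> n"
        and eq: "lab \<phi> = lab \<phi>'" "tile \<phi> = tile \<phi>'" and v: "v \<in> V n" for \<phi> \<phi>' v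
    proof -
      have labv: "lab \<phi> v = lab \<phi>' v" for v using eq by simp
      have B: "v \<in> B \<phi> \<longleftrightarrow> v \<in> B \<phi>'" if "v \<in> V n" for v
        using labv[of v] that unfolding lab_def by (auto split: if_splits)
      have pair: "restrict (\<phi> v) W0 = restrict (\<phi>' v) W0"
        "(\<lambda>t\<in>T'. \<phi> (act n (inv t) v) \<one>) = (\<lambda>t\<in>T'. \<phi>' (act n (inv t) v) \<one>)"
        if "v \<in> V n" "v \<in> B \<phi>" for v
        using labv[of v] that B[of v] unfolding lab_def by auto
      show ?thesis
      proof (rule microstates_determined[where B = "B \<phi>", OF n W0(2), folded T'_def])
        show "d u v < \<epsilon>" if "u \<in> orbit_cl" "v \<in> orbit_cl" "\<forall>w\<in>W0. u w = v w" for u v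
          using W0(3) that by blast
        show "\<phi> v \<in> orbit_cl" "\<phi>' v \<in> orbit_cl" if "v \<in> V n" for v
          using Maps_in[OF \<phi> that] Maps_in[OF \<phi>' that] by auto
        show "\<phi> (act n (inv w) v) \<one> = \<phi> v w" if "v \<in> V n" "v \<notin> B \<phi>" "w \<in> W0 \<union> T'" for v w
          using good[OF \<phi> that] .
        show "\<phi>' (act n (inv w) v) \<one> = \<phi>' v w" if "v \<in> V n" "v \<notin> B \<phi>" "w \<in> W0 \<union> T'" for v w
          using good[OF \<phi>' that(1) _ that(3)] that(2) B[OF that(1)] by simp
        show "\<phi> c t = \<phi>' c t" if "c \<in> ?sub" "t \<in> T'" for c t
          using fun_cong[OF fun_cong[OF eq(2)], of c t] that unfolding tile_def by simp
        show "\<phi> v w = \<phi>' v w" if "v \<in> V n" "v \<in> B \<phi>" "w \<in> W0" for v w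
          using fun_cong[OF pair(1)[OF that(1,2)], of w] that by simp
        show "\<phi> (act n (inv t) v) \<one> = \<phi>' (act n (inv t) v) \<one>" if "v \<in> V n" "v \<in> B \<phi>" "t \<in> T'" for v t
          using fun_cong[OF pair(2)[OF that(1,2)], of t] that by simp
      qed (fact v)
    qed
    have bound: "card R \<le> card \<Lambda> * (?M * k ^ ?h) ^ card ?sub"
      if R: "R \<subseteq> Maps W \<delta> n" "\<forall>\<phi>\<in>R. \<forall>\<phi>'\<in>R. \<phi> \<noteq> \<phi>' \<longrightarrow> dist_inf (V n) d \<phi> \<phi>' > \<epsilon>" for R
    proof -
      have "inj_on (\<lambda>\<phi>. (lab \<phi>, tile \<phi>)) R"
      proof (rule inj_onI, rule ccontr)
        fix \<phi> \<phi>' assume f: "\<phi> \<in> R" "\<phi>' \<in> R" "(lab \<phi>, tile \<phi>) = (lab \<phi>', tile \<phi>')" "\<phi> \<noteq> \<phi>'"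
        then have "d (\<phi> v) (\<phi>' v) < \<epsilon>" if "v \<in> V n" for v
          using close[of \<phi> \<phi>' v] that R(1) by auto
        then have "dist_inf (V n) d \<phi> \<phi>' < \<epsilon>"
          unfolding dist_inf_def using finite_V V_nonempty by (subst Max_less_iff) auto
        then show False using R(2) f by fastforce
      qed
      then have "card R \<le> card (\<Lambda> \<times> (?sub \<rightarrow>\<^sub>E ?lang))"
      proof (rule card_inj_on_le)
        show "(\<lambda>\<phi>. (lab \<phi>, tile \<phi>)) ` R \<subseteq> \<Lambda> \<times> (?sub \<rightarrow>\<^sub>E ?lang)"
          using lab_in tile_in R(1) by (intro image_subsetI SigmaI) auto
        show "finite (\<Lambda> \<times> (?sub \<rightarrow>\<^sub>E ?lang))"
          using fin\<Lambda> finsub finlang by (intro finite_cartesian_product finite_PiE)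
      qed
      also have "\<dots> = card \<Lambda> * card ?lang ^ card ?sub"
        using finsub by (simp add: card_cartesian_product card_PiE)
      also have "\<dots> \<le> card \<Lambda> * (?M * k ^ ?h) ^ card ?sub"
        unfolding T'_def by (intro mult_left_mono power_mono card_language) auto
      finally show ?thesis .
    qed
    have "(\<lambda>v\<in>V n. None) \<in> \<Lambda>" using \<eta>(1) unfolding \<Lambda>_def by auto
    then have pos\<Lambda>: "card \<Lambda> > 0" using fin\<Lambda> by (auto simp: card_gt_0_iff)
    have M: "?M > 0" and N: "real (card (V n)) = ?M * card ?sub"
      using card_V_pos card_V_refine[OF n] by auto
    have "real (card \<Lambda>) \<le> exp (\<tau> * card (V n))" using \<eta>(2)[OF finite_V[of n]] unfolding \<Lambda>_def .
    then have "ln (real (card \<Lambda>)) \<le> ln (exp (\<tau> * card (V n)))" using pos\<Lambda> by (subst ln_le_cancel_iff) auto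
    then have 1: "ln (real (card \<Lambda>)) \<le> \<tau> * card (V n)" by simp
    have "ln (real (card \<Lambda> * (?M * k ^ ?h) ^ card ?sub))
      = ln (real (card \<Lambda>)) + card ?sub * (ln ?M + ?h * ln k)"
      using pos\<Lambda> M k by (simp add: ln_mult ln_realpow)
    also have "card ?sub * (ln ?M + ?h * ln k) = rate j * card (V n)"
      unfolding rate_def N using M by simp
    finally have 2: "ln (real (card \<Lambda> * (?M * k ^ ?h) ^ card ?sub)) \<le> (\<tau> + rate j) * card (V n)"
      using 1 by (simp add: distrib_right)
    show ?thesis
    proof (rule log_enat_le)
      show "sep_number \<epsilon> (Maps W \<delta> n) (dist_inf (V n) d) \<le> enat (card \<Lambda> * (?M * k ^ ?h) ^ card ?sub)"
        by (rule sep_number_le) (use bound in auto)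
      show "card \<Lambda> * (?M * k ^ ?h) ^ card ?sub > 0" using pos\<Lambda> M k by simp
    qed (fact 2)
  qed
  then show ?thesis using W(1,2) \<delta> by (intro exI[of _ W] exI[of _ \<delta>]) auto
qed

lemma rate_eventually_le:
  assumes "c > 0"
  shows "\<exists>j. rate j \<le> \<kappa> * ln k + c"
proof -
  let ?N = "\<lambda>j. real (card (V (r j)))"
  have N: "filterlim ?N at_top sequentially"
    unfolding filterlim_at_top
  proof
    fix Z :: real
    obtain n0 where n0: "\<forall>n\<ge>n0. nat \<lceil>Z\<rceil> \<le> card (V n)" using card_V_unbounded by blast
    have "Z \<le> ?N j" if "j \<ge> n0" for j
    proof -
      have "r j \<ge> n0" using seq_suble[OF r, of j] that by simp
      then have "nat \<lceil>Z\<rceil> \<le> card (V (r j))" using n0 by blast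
      then show ?thesis by linarith
    qed
    then show "eventually (\<lambda>j. Z \<le> ?N j) sequentially" unfolding eventually_sequentially by blast
  qed
  have "(\<lambda>j. ln (?N j) / ?N j + ln k / ?N j) \<longlonglongrightarrow> 0 + 0"
    by (intro tendsto_add filterlim_compose[OF ln_x_over_x_tendsto_0 N]
        real_tendsto_divide_at_top[OF tendsto_const N])
  then have "eventually (\<lambda>j. ln (?N j) / ?N j + ln k / ?N j < c) sequentially"
    using assms by (intro order_tendstoD(2)) auto
  then obtain j where j: "ln (?N j) / ?N j + ln k / ?N j < c"
    by (meson eventually_sequentially order_refl)
  have pos: "?N j > 0" using card_V_pos by simp
  have "card (holes (r j) (A j)) * ln k \<le> (\<kappa> * ?N j + 1) * ln k"
    using few_holes[of j] k by (intro mult_right_mono) auto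
  then have "rate j \<le> (ln (?N j) + (\<kappa> * ?N j + 1) * ln k) / ?N j"
    unfolding rate_def using pos by (intro divide_right_mono add_left_mono) auto
  also have "\<dots> = ln (?N j) / ?N j + ln k / ?N j + \<kappa> * ln k"
    using pos by (simp add: field_simps)
  finally show ?thesis using j by (intro exI[of _ j]) linarith
qed

theorem sofic_entropy_wrt_eq:
  "sofic_entropy_wrt G V act (orbit_closure G k x) (shift G) d = ereal (\<kappa> * ln k)"
proof (rule antisym)
  let ?f = "\<lambda>\<epsilon> S \<delta> n. log_enat (sep_number \<epsilon> (Maps S \<delta> n) (dist_inf (V n) d)) / ereal (real (card (V n)))"
  let ?h = "\<lambda>\<epsilon>. INF S\<in>{S. S \<subseteq> carrier G \<and> finite S}. INF \<delta>\<in>{0<..}. limsup (?f \<epsilon> S \<delta>)"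
  have h: "sofic_entropy_wrt G V act (orbit_closure G k x) (shift G) d = (SUP \<epsilon>\<in>{0<..}. ?h \<epsilon>)"
    unfolding sofic_entropy_wrt_def orbit_closure_X ..
  have upper: "?h \<epsilon> \<le> ereal (\<kappa> * ln k)" if \<epsilon>: "\<epsilon> > 0" for \<epsilon>
  proof (rule ereal_le_epsilon2)
    fix c :: real assume c: "c > 0"
    then obtain j where j: "rate j \<le> \<kappa> * ln k + c/2" using rate_eventually_le[of "c/2"] by auto
    obtain S \<delta> where S: "finite S" "S \<subseteq> carrier G" "\<delta> > 0" "\<forall>n\<ge>r j.
      log_enat (sep_number \<epsilon> (Maps S \<delta> n) (dist_inf (V n) d)) \<le> ereal ((c/2 + rate j) * card (V n))"
      using few_microstates[OF \<epsilon>, of "c/2" j] c by auto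
    have "?f \<epsilon> S \<delta> n \<le> ereal (\<kappa> * ln k + c)" if n: "n \<ge> r j" for n
    proof -
      have N: "real (card (V n)) > 0" using card_V_pos by simp
      have "?f \<epsilon> S \<delta> n \<le> ereal ((c/2 + rate j) * card (V n)) / ereal (real (card (V n)))"
        using S(4) n N by (intro ereal_divide_right_mono) auto
      also have "\<dots> = ereal (c/2 + rate j)" using N by simp
      also have "\<dots> \<le> ereal (\<kappa> * ln k + c)" using j by simp
      finally show ?thesis .
    qed
    then have "limsup (?f \<epsilon> S \<delta>) \<le> ereal (\<kappa> * ln k + c)"
      by (intro Limsup_bounded) (auto simp: eventually_sequentially)
    then have "(INF \<delta>\<in>{0<..}. limsup (?f \<epsilon> S \<delta>)) \<le> ereal (\<kappa> * ln k + c)"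
      using S(3) by (intro INF_lower2[of \<delta>]) auto
    then have "?h \<epsilon> \<le> ereal (\<kappa> * ln k + c)"
      using S(1,2) by (intro INF_lower2[of S]) auto
    then show "?h \<epsilon> \<le> ereal (\<kappa> * ln k) + ereal c" by simp
  qed
  show "sofic_entropy_wrt G V act (orbit_closure G k x) (shift G) d \<le> ereal (\<kappa> * ln k)"
    unfolding h by (rule SUP_least) (use upper in auto)
  obtain \<epsilon> where \<epsilon>: "\<epsilon> > 0" "\<And>S \<delta>. finite S \<Longrightarrow> S \<subseteq> carrier G \<Longrightarrow> \<delta> > 0 \<Longrightarrow> \<exists>j0. \<forall>j\<ge>j0.
     enat (k ^ card (holes (r j) (A j))) \<le> sep_number \<epsilon> (Maps S \<delta> (r j)) (dist_inf (V (r j)) d)"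
    using ex_many_microstates by auto
  have lower: "ereal (\<kappa> * ln k) \<le> limsup (?f \<epsilon> S \<delta>)" if S: "S \<subseteq> carrier G" "finite S" "\<delta> > 0" for S \<delta>
  proof -
    obtain j0 where j0: "\<forall>j\<ge>j0. enat (k ^ card (holes (r j) (A j))) \<le>
      sep_number \<epsilon> (Maps S \<delta> (r j)) (dist_inf (V (r j)) d)" using \<epsilon>(2) S by blast
    have "ereal (\<kappa> * ln k) \<le> (?f \<epsilon> S \<delta> \<circ> r) j" if j: "j \<ge> j0" for j
    proof -
      let ?n = "r j"
      have N: "real (card (V ?n)) > 0" using card_V_pos by simp
      have "\<kappa> * card (V ?n) * ln k \<le> card (holes ?n (A j)) * ln k"
        using many_holes[of j] k by (intro mult_right_mono) auto
      also have "\<dots> = ln (real (k ^ card (holes ?n (A j))))" using k by (simp add: ln_realpow)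
      finally have "\<kappa> * card (V ?n) * ln k \<le> ln (real (k ^ card (holes ?n (A j))))" .
      then have "ereal (\<kappa> * card (V ?n) * ln k) \<le> log_enat (sep_number \<epsilon> (Maps S \<delta> ?n) (dist_inf (V ?n) d))"
        using j0 j k by (intro le_log_enat[of "k ^ card (holes ?n (A j))"]) auto
      then have "ereal (\<kappa> * card (V ?n) * ln k) / ereal (real (card (V ?n))) \<le> ?f \<epsilon> S \<delta> ?n"
        using N by (intro ereal_divide_right_mono) auto
      moreover have "ereal (\<kappa> * card (V ?n) * ln k) / ereal (real (card (V ?n))) = ereal (\<kappa> * ln k)"
        using N by simp
      ultimately show ?thesis by simp
    qed
    then have "ereal (\<kappa> * ln k) \<le> limsup (?f \<epsilon> S \<delta> \<circ> r)"
      by (intro le_Limsup) (auto simp: eventually_sequentially)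
    also have "\<dots> \<le> limsup (?f \<epsilon> S \<delta>)" by (rule limsup_subseq_mono[OF r])
    finally show ?thesis .
  qed
  have "ereal (\<kappa> * ln k) \<le> ?h \<epsilon>"
    by (intro INF_greatest) (use lower in auto)
  then show "ereal (\<kappa> * ln k) \<le> sofic_entropy_wrt G V act (orbit_closure G k x) (shift G) d"
    unfolding h by (rule SUP_upper2[rotated]) (use \<epsilon>(1) in auto)
qed

end

theorem theorem7p5:
  fixes G :: "('a, 'b) monoid_scheme" (structure)
    and H :: "nat \<Rightarrow> 'a set" and k :: nat and \<kappa> :: real
  assumes "group G"
    and "countable (carrier G)" and "infinite (carrier G)"
    and "residually_finite G"
    and "\<And>n. H n \<lhd> G" and "\<And>n. finite_index_subgroup G (H n)"
    and "\<And>n. H (Suc n) \<subseteq> H n"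
    and "(\<Inter>n. H n) = {\<one>}"
    and "k > 1" and "0 \<le> \<kappa>" and "\<kappa> < 1"
  shows "\<exists>x. toeplitz G k x \<and>
           sofic_entropy G (\<lambda>n. lcosets H n) (\<lambda>n. coset_action G (H n))
             (orbit_closure G k x) (shift G) = ereal (\<kappa> * ln (real k))"
proof -
  interpret group G by fact
  interpret coset_tower G H
    using assms by (intro coset_tower.intro coset_tower_axioms.intro) (auto simp: finite_index_subgroup_def)
  obtain x r A F where "toeplitz_array G H k \<kappa> x r A F"
    using ex_toeplitz_array assms by blast
  then interpret toeplitz_array G H k \<kappa> x r A F .
  let ?d = "SOME d. dyn_gen_pseudometric G (orbit_closure G k x) (shift G) d"
  interpret toeplitz_entropy G H k \<kappa> x r A F ?d
    by unfold_locales (rule someI_ex[OF ex_dyn_gen_pseudometric[OF assms(2)]])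
  show ?thesis
    using toeplitz_x sofic_entropy_wrt_eq unfolding sofic_entropy_def by blast
qed

end
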